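(* Let $K\subset\mathbb{C}$ be a totally imaginary number field of degree $[K:\mathbb{Q}]=2d\ge 4$, let $K^{\mathrm{gal}}/\mathbb{Q}$ be its Galois hull, let $G=\mathrm{Gal}(K^{\mathrm{gal}}/\mathbb{Q})$ act on $X=\mathrm{Hom}(K,\mathbb{C})$, and let $\tau\in G$ be the restriction of complex conjugation to $K^{\mathrm{gal}}$. Suppose that the triple $(G,X,\tau)$ satisfies condition $( ** )$, i.e. $c(G,X,\tau)>\tfrac12|X|=d$. Let $l\in K[x_1,x_2,x_3]$ be a linear form with sufficiently general coefficients. Then the form $f=N_{K/\mathbb{Q}}(l)\in\mathbb{Q}[x_1,x_2,x_3]$ is not a sum of squares of polynomials in $\mathbb{Q}[x_1,x_2,x_3]$.
   Context: The Galois hull $K^{\mathrm{gal}}$ is taken inside $\mathbb{C}$. Every embedding $x\in X=\mathrm{Hom}(K,\mathbb{C})$ has image in $K^{\mathrm{gal}}$, and $G$ acts on $X$ by $\sigma x=\sigma\circ x$; this action is transitive and faithful, $|X|=2d$, and $\tau$ is an involution acting on $X$ without fixed points since $K$ has no real place. Characteristic number: let a finite group $G$ act transitively and faithfully on a finite set $X$, and let $t\in G$ be an involution ($t^2=1$) acting on $X$ without fixed points. For $x\in X$ put $M_t(x)=\{gtg^{-1}x : g\in G\}$. The cardinality $|M_t(x)|$ does not depend on $x\in X$; it is denoted $c(G,X,t)$ and called the characteristic number of $(G,X,t)$. The triple $(G,X,t)$ has property $( ** )$ if $c(G,X,t)>\frac12|X|$. Norm form: for a linear form $l\in K[x_1,x_2,x_3]$,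 $N_{K/\mathbb{Q}}(l)$ is the product of the $2d$ Galois conjugates of $l$, i.e. of the forms obtained by applying the $2d$ embeddings $K\to\mathbb{C}$ to the coefficients of $l$; it is a form of degree $2d$ with coefficients in $\mathbb{Q}$. The form $l$ has "sufficiently general coefficients" if no three of the $2d$ Galois conjugates of $l$ have a common nontrivial complex zero. *)

theory Defs
  imports
    "HOL-Algebra.Group_Action"
    "HOL-Algebra.Algebraic_Closure_Type"
    "HOL-Analysis.Finite_Cartesian_Product"
    "HOL-Library.Numeral_Type"
    "HOL-Library.Poly_Mapping"
    "HOL-Computational_Algebra.Polynomial_Factorial"
begin

abbreviation complex_field :: "complex ring" where
  "complex_field \<equiv> ring_of_type_algebra"

abbreviation subfield_ring :: "complex set \<Rightarrow> complex ring" where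
  "subfield_ring K \<equiv> complex_field\<lparr>carrier := K\<rparr>"

definition number_field_of_degree :: "complex set \<Rightarrow> nat \<Rightarrow> bool" where
  "number_field_of_degree K n \<longleftrightarrow>
     subfield K complex_field \<and> ring.dimension complex_field n \<rat> K"

text \<open>The set $\mathrm{Hom}(K, \mathbf{C})$. Maps are extensional (arbitrary but fixed
  outside \<open>K\<close>), so that two embeddings are equal iff they agree on \<open>K\<close>.\<close>

definition embeddings :: "complex set \<Rightarrow> (complex \<Rightarrow> complex) set" where
  "embeddings K = ring_hom (subfield_ring K) complex_field \<inter> extensional K"

definition totally_imaginary :: "complex set \<Rightarrow> bool" where
  "totally_imaginary K \<longleftrightarrow> (\<forall>x\<in>embeddings K. \<not> x ` K \<subseteq> \<real>)"

text \<open>\<open>L\<close> is a Galois extension of the rationals: algebraic and normal. Separability is automatic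
  in characteristic zero.\<close>

definition galois_over_Q :: "complex set \<Rightarrow> bool" where
  "galois_over_Q L \<longleftrightarrow>
     subfield L complex_field \<and>
     (\<forall>z\<in>L. \<exists>p :: rat poly. p \<noteq> 0 \<and> poly (map_poly of_rat p) z = 0) \<and>
     (\<forall>p :: rat poly. comm_semiring_1_class.irreducible p \<longrightarrow>
        (\<exists>z\<in>L. poly (map_poly of_rat p) z = 0) \<longrightarrow>
        (\<forall>z :: complex. poly (map_poly of_rat p) z = 0 \<longrightarrow> z \<in> L))"

text \<open>For algebraic \<open>K\<close> the intersection is itself Galois, hence the smallest Galois extension of
  the rationals containing \<open>K\<close>.\<close>

definition galois_hull :: "complex set \<Rightarrow> complex set" where
  "galois_hull K = \<Inter>{L. galois_over_Q L \<and> K \<subseteq> L}"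

definition galois_group :: "complex set \<Rightarrow> (complex \<Rightarrow> complex) monoid" where
  "galois_group L = (BijGroup L)
     \<lparr>carrier := {\<sigma> \<in> Bij L. \<sigma> \<in> ring_iso (subfield_ring L) (subfield_ring L) \<and>
                             (\<forall>q\<in>\<rat>. \<sigma> q = q)}\<rparr>"

text \<open>The action $\sigma x = \sigma \circ x$ on $\mathrm{Hom}(K, \mathbf{C})$, as a map into
  \<open>BijGroup (embeddings K)\<close>.\<close>

definition embedding_action ::
    "complex set \<Rightarrow> (complex \<Rightarrow> complex) \<Rightarrow> (complex \<Rightarrow> complex) \<Rightarrow> complex \<Rightarrow> complex" where
  "embedding_action K \<sigma> = (\<lambda>x\<in>embeddings K. compose K \<sigma> x)"

definition restricted_conjugation :: "complex set \<Rightarrow> complex \<Rightarrow> complex" where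
  "restricted_conjugation L = restrict cnj L"

text \<open>As for \<open>group_action\<close>, \<open>\<phi>\<close> is the action of \<open>G\<close> on \<open>E\<close>.\<close>

definition conjugate_orbit ::
    "('g, 'b) monoid_scheme \<Rightarrow> ('g \<Rightarrow> 'x \<Rightarrow> 'x) \<Rightarrow> 'g \<Rightarrow> 'x \<Rightarrow> 'x set" where
  "conjugate_orbit G \<phi> t x =
     {\<phi> (g \<otimes>\<^bsub>G\<^esub> t \<otimes>\<^bsub>G\<^esub> inv\<^bsub>G\<^esub> g) x | g. g \<in> carrier G}"

text \<open>The common cardinality of the sets \<open>conjugate_orbit G \<phi> t x\<close>; when the action is
  transitive it does not depend on \<open>x\<close>.\<close>

definition characteristic_number ::
    "('g, 'b) monoid_scheme \<Rightarrow> 'x set \<Rightarrow> ('g \<Rightarrow> 'x \<Rightarrow> 'x) \<Rightarrow> 'g \<Rightarrow> nat" where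
  "characteristic_number G E \<phi> t = (THE c. \<forall>x\<in>E. card (conjugate_orbit G \<phi> t x) = c)"

definition property_star_star ::
    "('g, 'b) monoid_scheme \<Rightarrow> 'x set \<Rightarrow> ('g \<Rightarrow> 'x \<Rightarrow> 'x) \<Rightarrow> 'g \<Rightarrow> bool" where
  "property_star_star G E \<phi> t \<longleftrightarrow>
     real (characteristic_number G E \<phi> t) > 1/2 * real (card E)"

text \<open>Polynomials in three variables: finitely supported maps from monomials (exponent vectors
  indexed by the three-element type) to coefficients.\<close>

type_synonym 'a mpoly3 = "(3 \<Rightarrow>\<^sub>0 nat) \<Rightarrow>\<^sub>0 'a"

definition monom_degree :: "(3 \<Rightarrow>\<^sub>0 nat) \<Rightarrow> nat" where
  "monom_degree m = (\<Sum>i\<in>UNIV. Poly_Mapping.lookup m i)"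

definition eval3 :: "'a::comm_semiring_1 mpoly3 \<Rightarrow> 'a ^ 3 \<Rightarrow> 'a" where
  "eval3 p v = (\<Sum>m\<in>Poly_Mapping.keys p.
     Poly_Mapping.lookup p m * (\<Prod>i\<in>UNIV. vec_nth v i ^ Poly_Mapping.lookup m i))"

definition linear_form_over :: "complex set \<Rightarrow> complex mpoly3 \<Rightarrow> bool" where
  "linear_form_over K l \<longleftrightarrow>
     (\<forall>m. Poly_Mapping.lookup l m \<in> K) \<and> (\<forall>m\<in>Poly_Mapping.keys l. monom_degree m = 1)"

text \<open>\<open>Poly_Mapping.map h\<close> applies \<open>h\<close> to the nonzero coefficients only, which for
  \<open>h 0 = 0\<close> is the same as applying it to all of them.\<close>

abbreviation map_coeffs :: "('a::zero \<Rightarrow> 'b::zero) \<Rightarrow> 'a mpoly3 \<Rightarrow> 'b mpoly3" where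
  "map_coeffs h p \<equiv> Poly_Mapping.map h p"

definition norm_form :: "complex set \<Rightarrow> complex mpoly3 \<Rightarrow> complex mpoly3" where
  "norm_form K l = (\<Prod>x\<in>embeddings K. map_coeffs x l)"

text \<open>The Galois conjugates of \<open>l\<close> form a family indexed by the embeddings of \<open>K\<close>: conjugates for
  distinct embeddings count as distinct members even if they coincide as polynomials.\<close>

definition sufficiently_general :: "complex set \<Rightarrow> complex mpoly3 \<Rightarrow> bool" where
  "sufficiently_general K l \<longleftrightarrow>
     (\<forall>x\<in>embeddings K. \<forall>y\<in>embeddings K. \<forall>z\<in>embeddings K.
        x \<noteq> y \<and> x \<noteq> z \<and> y \<noteq> z \<longrightarrow>
        \<not> (\<exists>v. v \<noteq> 0 \<and> eval3 (map_coeffs x l) v = 0 \<and>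
               eval3 (map_coeffs y l) v = 0 \<and> eval3 (map_coeffs z l) v = 0))"

definition is_sum_of_squares :: "'a::semiring_1 \<Rightarrow> bool" where
  "is_sum_of_squares f \<longleftrightarrow> (\<exists>ps. f = (\<Sum>p\<leftarrow>ps. p ^ 2))"

end

theory Submission
  imports Defs "HOL-Analysis.Cartesian_Space"
begin

text \<open>
  Write $2k = |X|$ and suppose $f = \sum_i p_i^2$; one may replace each $p_i$ by its part of degree
  \<open>k\<close>. For an embedding \<open>z\<close> the lines of the conjugate forms $l_z$ and $l_{\tau z}$ meet in a
  real point, where \<open>f\<close> and hence every $p_i$ vanishes. As $p_i$ is rational, it also vanishes at the
  Galois conjugates of these points, so on the line $l_x = 0$ it vanishes at its intersection with
  $l_y = 0$ for every $y \in M_\tau(x)$. These are more than \<open>k\<close> distinct points, so $p_i$ vanishes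
  on all $2k > k$ lines $l_x = 0$ and is zero.
\<close>

text \<open>Zeros move between conjugate points because \<open>hpart\<close> and
  \<open>cross\<close> use only ring operations and rational constants, so both respect every
  partial embedding. The starting points must be real: only there does a vanishing sum of squares
  force each square to vanish. They are real because the cross product of a coefficient vector with
  its complex conjugate is purely imaginary. \<open>property_star_star\<close> supplies more than k
  points on each line, and sufficient generality makes them distinct, since no three of the lines
  are concurrent. The set X enters through three facts: it is finite; it has at least three
  elements, by \<open>property_star_star\<close> and x lying outside its own orbit; and its size is
  even, since f is nonnegative on real vectors. On the field side a single extension theorem, proved
  with Zorn's lemma for graphs of embeddings, gives both transitivity on X and the rationality of
  numbers fixed by the Galois group, hence the rationality of f. The contradiction is drawn at one
  real vector off all the lines: there f is a product of nonzero factors, while every degree-k part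
  vanishes.\<close>

no_notation fps_nth (infixl "$" 75)

section \<open>Embeddings of fields of algebraic numbers\<close>

lemma map_poly_of_rat_mult:
  "map_poly of_rat (p * q) = map_poly of_rat p * (map_poly of_rat q :: 'a::field_char_0 poly)"
  by (intro poly_eqI) (simp add: coeff_map_poly coeff_mult of_rat_sum of_rat_mult)

text \<open>The graph of an embedding of a ring of algebraic numbers. Closure under inverses is not
  required, since the inverse of an algebraic number is a rational polynomial in it; thus all axioms
  are preserved by unions of chains.\<close>

locale partial_embedding =
  fixes r :: "complex rel"
  assumes rat: "(of_rat q, of_rat q) \<in> r"
    and add: "(a, b) \<in> r \<Longrightarrow> (a', b') \<in> r \<Longrightarrow> (a + a', b + b') \<in> r"
    and mult: "(a, b) \<in> r \<Longrightarrow> (a', b') \<in> r \<Longrightarrow> (a * a', b * b') \<in> r"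
    and zero_unique: "(0, b) \<in> r \<Longrightarrow> b = 0"
    and alg: "(a, b) \<in> r \<Longrightarrow> \<exists>p :: rat poly. p \<noteq> 0 \<and> poly (map_poly of_rat p) a = 0"
begin

lemma zero: "(0, 0) \<in> r" and one: "(1, 1) \<in> r"
  using rat[of 0] rat[of 1] by auto

lemma uminus: "(a, b) \<in> r \<Longrightarrow> (- a, - b) \<in> r"
  using mult[OF rat[of "-1"]] by (fastforce simp: of_rat_minus)

lemma diff: "(a, b) \<in> r \<Longrightarrow> (a', b') \<in> r \<Longrightarrow> (a - a', b - b') \<in> r"
  using add[OF _ uminus] by fastforce

lemma single_valued: "(a, b) \<in> r \<Longrightarrow> (a, b') \<in> r \<Longrightarrow> b = b'"
  using diff[of a b a b'] zero_unique by fastforce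

lemma sum: "(\<And>i. i \<in> A \<Longrightarrow> (f i, g i) \<in> r) \<Longrightarrow> (sum f A, sum g A) \<in> r"
  by (induction A rule: infinite_finite_induct) (auto intro: zero add)

lemma prod: "(\<And>i. i \<in> A \<Longrightarrow> (f i, g i) \<in> r) \<Longrightarrow> (prod f A, prod g A) \<in> r"
  by (induction A rule: infinite_finite_induct) (auto intro: one mult)

lemma power: "(a, b) \<in> r \<Longrightarrow> (a ^ n, b ^ n) \<in> r"
  by (induction n) (auto intro: one mult)

lemma rat_poly:
  "(a, b) \<in> r \<Longrightarrow> (poly (map_poly of_rat p) a, poly (map_poly of_rat p) b) \<in> r"
  by (induction p) (auto simp: map_poly_pCons intro!: zero add mult rat)

lemma rat_poly_root:
  "(a, b) \<in> r \<Longrightarrow> poly (map_poly of_rat p) a = 0 \<Longrightarrow> poly (map_poly of_rat p) b = 0"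
  using rat_poly[of a b p] zero_unique by simp

text \<open>Cancelling the powers of the indeterminate from a rational polynomial annihilating
  \<open>a\<close> leaves \<open>q\<close> = c + X g with c nonzero. At any root z of
  \<open>q\<close> the inverse is -g(z)/c. As \<open>b\<close> is a root of \<open>q\<close> too,
  the same rational polynomial computes both inverses.\<close>

lemma inverse:
  assumes "(a, b) \<in> r" "a \<noteq> 0"
  shows "b \<noteq> 0" and "(inverse a, inverse b) \<in> r"
proof -
  obtain p :: "rat poly" where p: "p \<noteq> 0" "poly (map_poly of_rat p) a = 0"
    using alg[OF assms(1)] by blast
  obtain q where q: "p = [:-0, 1:] ^ order 0 p * q" "\<not> [:-0, 1:] dvd q"
    using order_decomp[OF p(1)] by blast
  have X: "poly (map_poly of_rat ([:-0, 1:] ^ k)) z = z ^ k" for z :: complex and k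
    by (induction k) (auto simp: map_poly_of_rat_mult map_poly_pCons simp del: mult_pCons_left)
  have "poly (map_poly of_rat ([:-0, 1:] ^ order 0 p * q)) a = 0"
    using p(2) q(1) by metis
  then have "poly (map_poly of_rat q) a = 0"
    using assms(2) by (simp only: map_poly_of_rat_mult X poly_mult) simp
  obtain c g where cg: "q = pCons c g"
    by (cases q)
  have c: "c \<noteq> 0"
    using q(2) unfolding poly_eq_0_iff_dvd[symmetric] cg by simp
  define h :: "complex poly" where "h = map_poly of_rat (smult (-1/c) g)"
  have h: "z * poly h z = 1" if "poly (map_poly of_rat q) z = 0" for z :: complex
  proof -
    have hg: "h = smult (of_rat (-1/c)) (map_poly of_rat g)"
      unfolding h_def by (intro poly_eqI) (simp add: coeff_map_poly flip: of_rat_mult)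
    have "of_rat c + z * poly (map_poly of_rat g) z = 0"
      using that by (simp add: cg map_poly_pCons)
    then have *: "z * poly (map_poly of_rat g) z = - of_rat c"
      by (simp add: add_eq_0_iff2)
    have "z * poly h z = of_rat (-1/c) * (z * poly (map_poly of_rat g) z)"
      by (simp add: hg)
    also have "\<dots> = 1" unfolding * using c by (simp add: of_rat_divide of_rat_minus)
    finally show ?thesis .
  qed
  have ha: "a * poly h a = 1" using h \<open>poly (map_poly of_rat q) a = 0\<close> by blast
  have hb: "b * poly h b = 1" using h rat_poly_root[OF assms(1) \<open>poly (map_poly of_rat q) a = 0\<close>] by blast
  show "b \<noteq> 0" using hb by auto
  show "(inverse a, inverse b) \<in> r"
    using rat_poly[OF assms(1), of "smult (-1/c) g"] ha hb
    unfolding h_def[symmetric] by (metis inverse_unique)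
qed

lemma injective: "(a, b) \<in> r \<Longrightarrow> (a', b) \<in> r \<Longrightarrow> a = a'"
  using diff[of a b a' b] inverse(1)[of "a - a'" 0] by fastforce

text \<open>Graph of the coefficientwise map on polynomials induced by the embedding.\<close>

definition poly_rel :: "complex poly \<Rightarrow> complex poly \<Rightarrow> bool" where
  "poly_rel p q \<longleftrightarrow> (\<forall>i. (poly.coeff p i, poly.coeff q i) \<in> r)"

lemma poly_rel_add: "poly_rel p q \<Longrightarrow> poly_rel p' q' \<Longrightarrow> poly_rel (p + p') (q + q')"
  and poly_rel_diff: "poly_rel p q \<Longrightarrow> poly_rel p' q' \<Longrightarrow> poly_rel (p - p') (q - q')"
  and poly_rel_mult: "poly_rel p q \<Longrightarrow> poly_rel p' q' \<Longrightarrow> poly_rel (p * p') (q * q')"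
  unfolding poly_rel_def by (auto simp: coeff_mult intro: add diff sum mult)

lemma poly_rel_monom: "(a, b) \<in> r \<Longrightarrow> poly_rel (Polynomial.monom a n) (Polynomial.monom b n)"
  unfolding poly_rel_def by (auto intro: zero)

lemma poly_rel_rat: "poly_rel (map_poly of_rat p) (map_poly of_rat p)"
  unfolding poly_rel_def by (auto simp: coeff_map_poly intro: rat)

lemma poly_rel_0: "poly_rel 0 q \<Longrightarrow> q = 0"
  unfolding poly_rel_def by (intro poly_eqI) (auto intro: zero_unique)

text \<open>The candidate extension sending \<open>a\<close> to \<open>b\<close>, on all polynomial
  expressions in \<open>a\<close>. As a relation it can be formed before it is known to be
  single-valued.\<close>

definition adjoin :: "complex \<Rightarrow> complex \<Rightarrow> complex rel" where
  "adjoin a b = {(poly p a, poly q b) | p q. poly_rel p q}"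

lemma subset_adjoin: "r \<subseteq> adjoin a b"
proof
  fix z assume "z \<in> r"
  then obtain u v where "z = (u, v)" "poly_rel (Polynomial.monom u 0) (Polynomial.monom v 0)"
    using poly_rel_monom by (cases z) blast
  then show "z \<in> adjoin a b"
    unfolding adjoin_def by (force simp: poly_monom)
qed

lemma mem_adjoin: "(a, b) \<in> adjoin a b"
  unfolding adjoin_def using poly_rel_monom[OF one, of 1] by (force simp: poly_monom)

text \<open>The minimal polynomial of \<open>a\<close> over the domain of \<open>r\<close>, paired
  with its image. The pair (\<open>p0\<close>, \<open>p0\<close>) shows that candidates exist, and
  \<open>inverse\<close> allows both components to be made monic. The image keeps the degree because
  1 is sent to 1 and 0 to 0; its positive degree later yields a complex root.\<close>

lemma minimal_poly_rel:
  fixes a :: complex and p0 :: "rat poly"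
  assumes "p0 \<noteq> 0" "poly (map_poly of_rat p0) a = 0"
  obtains m m' where "poly_rel m m'" "poly m a = 0" "Polynomial.lead_coeff m = 1"
    "Polynomial.lead_coeff m' = 1" "Polynomial.degree m' = Polynomial.degree m"
    "Polynomial.degree m > 0"
    "\<And>p q. poly_rel p q \<Longrightarrow> p \<noteq> 0 \<Longrightarrow> poly p a = 0 \<Longrightarrow> Polynomial.degree m \<le> Polynomial.degree p"
proof -
  define P where "P = (\<lambda>(p, q). poly_rel p q \<and> p \<noteq> 0 \<and> poly p a = 0)"
  have "P (map_poly of_rat p0, map_poly of_rat p0)"
    unfolding P_def using assms poly_rel_rat by (auto simp: map_poly_eq_0_iff)
  then obtain n n' where n: "P (n, n')" and
    min: "\<And>z. P z \<Longrightarrow> Polynomial.degree n \<le> Polynomial.degree (fst z)"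
    using ex_has_least_nat[of P _ "\<lambda>z. Polynomial.degree (fst z)"] by (metis prod.collapse fst_conv)
  define k where "k = Polynomial.degree n"
  let ?c = "inverse (Polynomial.coeff n k)" and ?c' = "inverse (Polynomial.coeff n' k)"
  have nk: "Polynomial.coeff n k \<noteq> 0" using n unfolding P_def k_def by auto
  have nr: "(Polynomial.coeff n k, Polynomial.coeff n' k) \<in> r"
    using n unfolding P_def poly_rel_def by auto
  define m where "m = smult ?c n"
  define m' where "m' = smult ?c' n'"
  have rel: "poly_rel m m'"
    using n unfolding P_def poly_rel_def m_def m'_def by (auto intro!: mult inverse nr nk)
  have dm: "Polynomial.degree m = k" and lm: "Polynomial.coeff m k = 1" using nk by (auto simp: m_def k_def)
  have root: "poly m a = 0" using n by (auto simp: P_def m_def)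
  have lm': "Polynomial.coeff m' k = 1"
    using rel lm single_valued[OF _ one] unfolding poly_rel_def by metis
  have "Polynomial.coeff m' i = 0" if "i > k" for i
    using rel coeff_eq_0[of m i] that dm zero_unique unfolding poly_rel_def by metis
  then have dm': "Polynomial.degree m' = k"
    using lm' by (metis le_degree degree_le le_antisym zero_neq_one)
  have "k > 0"
  proof (rule ccontr)
    assume "\<not> k > 0"
    then have "m = 1" using dm lm by (metis degree_eq_zeroE coeff_pCons_0 neq0_conv one_pCons)
    then show False using root by simp
  qed
  show ?thesis
  proof (rule that[of m m'])
    show "Polynomial.degree m \<le> Polynomial.degree p" if "poly_rel p q" "p \<noteq> 0" "poly p a = 0" for p q
      using min[of "(p, q)"] that dm unfolding P_def k_def by auto
  qed (use rel dm dm' lm lm' root \<open>k > 0\<close> in auto)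
qed

text \<open>Division by the minimal polynomial, carried out on both components at once: subtracting
  matching monomial multiples of \<open>m\<close> and \<open>m'\<close> cancels the leading term of
  \<open>p\<close> and leaves the value of \<open>q\<close> at \<open>b\<close> unchanged.
  Minimality ensures that a nonzero \<open>p\<close> has degree large enough for the next
  step.\<close>

lemma poly_rel_root:
  assumes m: "poly_rel m m'" "poly m a = 0" "Polynomial.lead_coeff m = 1"
    "Polynomial.degree m > 0"
    and min: "\<And>p q. poly_rel p q \<Longrightarrow> p \<noteq> 0 \<Longrightarrow> poly p a = 0 \<Longrightarrow> Polynomial.degree m \<le> Polynomial.degree p"
    and b: "poly m' b = 0"
  shows "poly_rel p q \<Longrightarrow> poly p a = 0 \<Longrightarrow> poly q b = 0"
proof (induction "Polynomial.degree p" arbitrary: p q rule: less_induct)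
  case less
  show ?case
  proof (cases "p = 0")
    case True
    then have "q = 0" using less.prems(1) poly_rel_0 by blast
    then show ?thesis by simp
  next
    case False
    define n where "n = Polynomial.degree p"
    define k where "k = Polynomial.degree m"
    have kn: "k \<le> n" using min[OF less.prems(1) False less.prems(2)] by (simp add: k_def n_def)
    define s where "s = Polynomial.monom (Polynomial.coeff p n) (n - k)"
    define s' where "s' = Polynomial.monom (Polynomial.coeff q n) (n - k)"
    have s: "poly_rel s s'" unfolding s_def s'_def
      using less.prems(1) by (intro poly_rel_monom) (auto simp: poly_rel_def)
    have rel: "poly_rel (p - s * m) (q - s' * m')"
      by (intro poly_rel_diff poly_rel_mult less.prems s m)
    have pa: "poly (p - s * m) a = 0" using less.prems m by simp
    have "Polynomial.degree (s * m) \<le> n"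
      using degree_mult_le[of s m] degree_monom_le[of "Polynomial.coeff p n" "n - k"] kn
      unfolding s_def k_def by linarith
    then have "Polynomial.degree (p - s * m) \<le> n"
      by (intro degree_diff_le) (auto simp: n_def)
    moreover have "Polynomial.coeff (s * m) n = Polynomial.coeff p n"
      using kn m(3) by (simp add: s_def coeff_monom_mult k_def)
    ultimately have "p - s * m = 0 \<or> Polynomial.degree (p - s * m) < n"
      by (intro eq_zero_or_degree_less) auto
    then have "poly (q - s' * m') b = 0"
    proof
      assume "p - s * m = 0"
      with rel show ?thesis using poly_rel_0 by fastforce
    next
      assume "Polynomial.degree (p - s * m) < n"
      then show ?thesis using less.hyps rel pa n_def by blast
    qed
    then show ?thesis using b by simp
  qed
qed

text \<open>The hypothesis \<open>root\<close> is precisely the well-definedness of sending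
  \<open>a\<close> to \<open>b\<close>: it becomes \<open>zero_unique\<close> for the new
  relation.\<close>

lemma partial_embedding_adjoin:
  assumes L: "\<And>p q. poly_rel p q \<Longrightarrow> \<exists>p0 :: rat poly. p0 \<noteq> 0 \<and> poly (map_poly of_rat p0) (poly p a) = 0"
    and root: "\<And>p q. poly_rel p q \<Longrightarrow> poly p a = 0 \<Longrightarrow> poly q b = 0"
  shows "partial_embedding (adjoin a b)"
proof
  show "(of_rat q, of_rat q) \<in> adjoin a b" for q
    using rat subset_adjoin by blast
  fix u u' v v'
  assume "(u, v) \<in> adjoin a b" "(u', v') \<in> adjoin a b"
  then obtain p q p' q' where *: "poly_rel p q" "poly_rel p' q'"
    "u = poly p a" "v = poly q b" "u' = poly p' a" "v' = poly q' b"
    unfolding adjoin_def by auto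
  show "(u + u', v + v') \<in> adjoin a b"
    unfolding adjoin_def using poly_rel_add[OF *(1,2)] * by (metis (mono_tags, lifting) mem_Collect_eq poly_add)
  show "(u * u', v * v') \<in> adjoin a b"
    unfolding adjoin_def using poly_rel_mult[OF *(1,2)] * by (metis (mono_tags, lifting) mem_Collect_eq poly_mult)
next
  show "v = 0" if "(0, v) \<in> adjoin a b" for v
    using that root unfolding adjoin_def by auto
  show "\<exists>p0 :: rat poly. p0 \<noteq> 0 \<and> poly (map_poly of_rat p0) u = 0" if "(u, v) \<in> adjoin a b" for u v
    using that L unfolding adjoin_def by auto
qed

end

section \<open>Galois extensions inside the complex numbers\<close>

lemma subfield_complexD:
  assumes "subfield L complex_field"
  shows "0 \<in> L" "1 \<in> L" "a \<in> L \<Longrightarrow> b \<in> L \<Longrightarrow> a + b \<in> L" "a \<in> L \<Longrightarrow> b \<in> L \<Longrightarrow> a * b \<in> L"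
    "a \<in> L \<Longrightarrow> - a \<in> L" "a \<in> L \<Longrightarrow> Fields.inverse a \<in> L"
proof -
  interpret F: Ring.field complex_field by (rule field_from_type_algebra)
  note [simp] = ring_of_type_algebra_def
  show 0: "0 \<in> L" "1 \<in> L" "a \<in> L \<Longrightarrow> b \<in> L \<Longrightarrow> a + b \<in> L" "a \<in> L \<Longrightarrow> b \<in> L \<Longrightarrow> a * b \<in> L"
    using F.subring_props[OF assms] by auto
  have minus: "\<ominus>\<^bsub>complex_field\<^esub> a = - a" for a :: complex
    by (rule F.minus_equality) auto
  show "a \<in> L \<Longrightarrow> - a \<in> L"
    using F.subring_props(5)[OF assms] minus by metis
  show "Fields.inverse a \<in> L" if "a \<in> L"
  proof (cases "a = 0")
    case True
    then show ?thesis using 0 by simp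
  next
    case False
    have "inv\<^bsub>complex_field\<^esub> a = Fields.inverse a"
      by (rule F.comm_inv_char) (use False in auto)
    then show ?thesis using F.subfield_m_inv(1)[OF assms, of a] that False by simp
  qed
qed

lemma subfield_complexI:
  assumes "1 \<in> L" "\<And>a b. a \<in> L \<Longrightarrow> b \<in> L \<Longrightarrow> a + b \<in> L" "\<And>a b. a \<in> L \<Longrightarrow> b \<in> L \<Longrightarrow> a * b \<in> L"
    "\<And>a. a \<in> L \<Longrightarrow> - a \<in> L" "\<And>a. a \<in> L \<Longrightarrow> Fields.inverse a \<in> L"
  shows "subfield L complex_field"
proof -
  interpret F: Ring.field complex_field by (rule field_from_type_algebra)
  note [simp] = ring_of_type_algebra_def
  have minus: "\<ominus>\<^bsub>complex_field\<^esub> a = - a" for a :: complex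
    by (rule F.minus_equality) auto
  show ?thesis
  proof (rule F.subfieldI'[OF F.subringI])
    show "\<ominus>\<^bsub>complex_field\<^esub> a \<in> L" if "a \<in> L" for a using that assms(4) minus by simp
    show "inv\<^bsub>complex_field\<^esub> a \<in> L" if "a \<in> L - {\<zero>\<^bsub>complex_field\<^esub>}" for a
    proof -
      have "inv\<^bsub>complex_field\<^esub> a = Fields.inverse a"
        by (rule F.comm_inv_char) (use that in auto)
      then show ?thesis using assms(5) that by simp
    qed
  qed (use assms in auto)
qed

lemma of_rat_in_subfield:
  assumes "subfield L complex_field"
  shows "of_rat q \<in> L"
proof -
  note L = subfield_complexD[OF assms]
  have nat: "of_nat n \<in> L" for n by (induction n) (auto intro: L)
  have int: "of_int k \<in> L" for k
  proof (cases k)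
    case (neg n)
    then have "of_int k = - (of_nat (Suc n) :: complex)" by simp
    then show ?thesis using L(5)[OF nat] by metis
  qed (use nat in auto)
  obtain a b where "q = Rat.Fract a b" "b > 0" by (cases q) auto
  then have "(of_rat q :: complex) = of_int a * Fields.inverse (of_int b)"
    by (simp add: of_rat_rat divide_inverse)
  then show ?thesis using L int by auto
qed

lemma subfield_sum_mem:
  assumes "subfield L complex_field" "\<And>i. i \<in> A \<Longrightarrow> f i \<in> L"
  shows "sum f A \<in> L"
  using assms(2) by (induction A rule: infinite_finite_induct) (auto intro: subfield_complexD[OF assms(1)])

lemma subfield_poly_mem:
  assumes "subfield L complex_field" "a \<in> L" "\<And>i. poly.coeff p i \<in> L"
  shows "poly p a \<in> L"
proof -
  note L = subfield_complexD[OF assms(1)]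
  have "a ^ n \<in> L" for n by (induction n) (auto intro: L assms)
  then show ?thesis unfolding poly_altdef using assms(3) by (intro subfield_sum_mem[OF assms(1)] L(4))
qed

text \<open>Normality in \<open>galois_over_Q\<close> speaks of irreducible polynomials only, so an
  annihilating polynomial must first be replaced by one of its irreducible factors.\<close>

lemma irreducible_rat_poly_root:
  fixes p :: "rat poly" and z :: "'a :: field_char_0"
  assumes "p \<noteq> 0" "poly (map_poly of_rat p) z = 0"
  shows "\<exists>q :: rat poly. comm_semiring_1_class.irreducible q \<and> poly (map_poly of_rat q) z = 0"
  using assms
proof (induction "Polynomial.degree p" arbitrary: p rule: less_induct)
  case less
  have "\<not> p dvd 1"
  proof
    assume "p dvd 1"
    then obtain c where "p = [:c:]" using is_unit_iff_degree[OF less.prems(1)] by (metis degree_eq_zeroE)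
    then show False using less.prems by (simp add: map_poly_pCons)
  qed
  show ?case
  proof (cases "comm_semiring_1_class.irreducible p")
    case True
    then show ?thesis using less.prems by blast
  next
    case False
    then obtain a b where ab: "p = a * b" "\<not> a dvd 1" "\<not> b dvd 1"
      using \<open>\<not> p dvd 1\<close> less.prems unfolding comm_semiring_1_class.irreducible_def by auto
    have nz: "a \<noteq> 0" "b \<noteq> 0" using ab less.prems by auto
    have "Polynomial.degree a > 0" "Polynomial.degree b > 0"
      using ab nz by (simp_all add: is_unit_iff_degree)
    then have deg: "Polynomial.degree a < Polynomial.degree p" "Polynomial.degree b < Polynomial.degree p"
      using degree_mult_eq[OF nz] ab(1) by auto
    have "map_poly of_rat p = map_poly of_rat a * (map_poly of_rat b :: 'a poly)"
      unfolding ab(1) by (rule map_poly_of_rat_mult)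
    then have "poly (map_poly of_rat a) z = 0 \<or> poly (map_poly of_rat b) z = 0"
      using less.prems by auto
    then show ?thesis using less.hyps deg nz by blast
  qed
qed

text \<open>A maximal extension with domain inside \<open>L\<close> has domain \<open>L\<close>: any
  \<open>a\<close> in \<open>L\<close> can be adjoined by sending it to a root of the image of its
  minimal polynomial, and such a root exists in the complex numbers. The values of the extension are
  not yet confined to \<open>L\<close>.\<close>

lemma partial_embedding_extends:
  assumes L: "subfield L complex_field"
    and alg: "\<And>z. z \<in> L \<Longrightarrow> \<exists>p :: rat poly. p \<noteq> 0 \<and> poly (map_poly of_rat p) z = 0"
    and r: "partial_embedding r" "Domain r \<subseteq> L"
  shows "\<exists>s. r \<subseteq> s \<and> partial_embedding s \<and> Domain s = L"
proof -
  define \<A> where "\<A> = {s. r \<subseteq> s \<and> partial_embedding s \<and> Domain s \<subseteq> L}"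
  have "\<exists>M\<in>\<A>. \<forall>t\<in>\<A>. M \<subseteq> t \<longrightarrow> t = M"
  proof (rule subset_Zorn_nonempty)
    show "\<A> \<noteq> {}" using r unfolding \<A>_def by auto
    fix C assume C: "C \<noteq> {}" "subset.chain \<A> C"
    have mem: "partial_embedding s" "r \<subseteq> s" "Domain s \<subseteq> L" if "s \<in> C" for s
      using C(2) that unfolding subset_chain_def \<A>_def by auto
    obtain s0 where s0: "s0 \<in> C" using C(1) by auto
    have directed: "\<exists>s\<in>C. z \<in> s \<and> w \<in> s" if "z \<in> \<Union>C" "w \<in> \<Union>C" for z w
      using that C(2) unfolding subset_chain_def by blast
    have "partial_embedding (\<Union>C)"
    proof
      show "(of_rat q, of_rat q) \<in> \<Union>C" for q using partial_embedding.rat[OF mem(1)] s0 by blast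
      fix a b a' b' assume "(a, b) \<in> \<Union>C" "(a', b') \<in> \<Union>C"
      then obtain s where "s \<in> C" "(a, b) \<in> s" "(a', b') \<in> s" using directed by blast
      then show "(a + a', b + b') \<in> \<Union>C" "(a * a', b * b') \<in> \<Union>C"
        using partial_embedding.add partial_embedding.mult mem by blast+
    qed (use mem partial_embedding.zero_unique partial_embedding.alg in blast)+
    then show "\<Union>C \<in> \<A>" unfolding \<A>_def using mem s0 by blast
  qed
  then obtain s where s: "s \<in> \<A>" and max: "\<And>t. t \<in> \<A> \<Longrightarrow> s \<subseteq> t \<Longrightarrow> t = s" by blast
  interpret s: partial_embedding s using s unfolding \<A>_def by auto
  have sub: "r \<subseteq> s" "Domain s \<subseteq> L" using s unfolding \<A>_def by auto
  have "L \<subseteq> Domain s"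
  proof
    fix a assume a: "a \<in> L"
    obtain p0 :: "rat poly" where p0: "p0 \<noteq> 0" "poly (map_poly of_rat p0) a = 0" using alg[OF a] by blast
    obtain m m' where m: "s.poly_rel m m'" "poly m a = 0" "Polynomial.lead_coeff m = 1"
      "Polynomial.lead_coeff m' = 1" "Polynomial.degree m' = Polynomial.degree m"
      "Polynomial.degree m > 0"
      "\<And>p q. s.poly_rel p q \<Longrightarrow> p \<noteq> 0 \<Longrightarrow> poly p a = 0 \<Longrightarrow> Polynomial.degree m \<le> Polynomial.degree p"
      using s.minimal_poly_rel[OF p0] by blast
    have "\<not> Fundamental_Theorem_Algebra.constant (poly m')"
      using m(5,6) by (simp add: constant_degree)
    then obtain b where b: "poly m' b = 0" using fundamental_theorem_of_algebra by blast
    have in_L: "poly p a \<in> L" if "s.poly_rel p q" for p q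
      using that sub(2) unfolding s.poly_rel_def by (intro subfield_poly_mem[OF L a]) blast
    have "partial_embedding (s.adjoin a b)"
      by (rule s.partial_embedding_adjoin[OF alg[OF in_L] s.poly_rel_root[OF m(1,2,3,6,7) b]])
    moreover have "Domain (s.adjoin a b) \<subseteq> L"
      unfolding s.adjoin_def using in_L by blast
    ultimately have "s.adjoin a b \<in> \<A>" unfolding \<A>_def using sub(1) s.subset_adjoin by blast
    then have "s.adjoin a b = s" using max s.subset_adjoin by blast
    then show "a \<in> Domain s" using s.mem_adjoin by (metis DomainI)
  qed
  then show ?thesis using s.partial_embedding_axioms sub by (intro exI[of _ s]) auto
qed

lemma galois_over_Q_D:
  assumes "galois_over_Q L"
  shows "subfield L complex_field"
    "z \<in> L \<Longrightarrow> \<exists>p :: rat poly. p \<noteq> 0 \<and> poly (map_poly of_rat p) z = 0"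
    "comm_semiring_1_class.irreducible p \<Longrightarrow> poly (map_poly of_rat p) z = 0 \<Longrightarrow> z \<in> L
      \<Longrightarrow> poly (map_poly of_rat p) w = 0 \<Longrightarrow> w \<in> L"
  using assms unfolding galois_over_Q_def by blast+

text \<open>Normality forces the extension to take values in \<open>L\<close>. Since
  \<open>L\<close> may be any Galois extension, possibly of infinite degree, surjectivity is argued
  one irreducible polynomial at a time.\<close>

lemma galois_group_extends:
  assumes gal: "galois_over_Q L" and r: "partial_embedding r" "Domain r \<subseteq> L"
  shows "\<exists>\<sigma>\<in>carrier (galois_group L). \<forall>a b. (a, b) \<in> r \<longrightarrow> \<sigma> a = b"
proof -
  note L = galois_over_Q_D[OF gal]
  obtain s where s: "r \<subseteq> s" "partial_embedding s" "Domain s = L"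
    using partial_embedding_extends[OF L(1,2) r] by auto
  interpret s: partial_embedding s by fact
  define \<sigma> where "\<sigma> = (\<lambda>a\<in>L. THE b. (a, b) \<in> s)"
  have mem: "(a, \<sigma> a) \<in> s" if "a \<in> L" for a
    using that s(3) s.single_valued unfolding \<sigma>_def by (auto intro!: theI2[where Q = "\<lambda>b. (a, b) \<in> s"])
  have eq: "\<sigma> a = b" if "(a, b) \<in> s" for a b
    using that mem s(3) s.single_valued by blast
  have inj: "inj_on \<sigma> L"
    by (intro inj_onI) (metis mem s.injective)
  have irr: "\<exists>p :: rat poly. comm_semiring_1_class.irreducible p \<and> poly (map_poly of_rat p) a = 0"
    if "a \<in> L" for a
    using irreducible_rat_poly_root L(2)[OF that] by blast
  have in_L: "\<sigma> a \<in> L" if "a \<in> L" for a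
    using irr[OF that] L(3) s.rat_poly_root[OF mem[OF that]] that by blast
  have surj: "\<sigma> ` L = L"
  proof
    show "\<sigma> ` L \<subseteq> L" using in_L by auto
    show "L \<subseteq> \<sigma> ` L"
    proof
      fix b assume b: "b \<in> L"
      obtain p :: "rat poly" where p: "comm_semiring_1_class.irreducible p" "poly (map_poly of_rat p) b = 0"
        using irr[OF b] by blast
      \<comment> \<open>The injective map \<open>\<sigma>\<close> sends this finite root set into
        itself, hence onto itself, so \<open>b\<close> is hit.\<close>
      define R where "R = {z :: complex. poly (map_poly of_rat p) z = 0}"
      have "p \<noteq> 0" using p by auto
      then have fin: "finite R" unfolding R_def by (intro poly_roots_finite) (simp add: map_poly_eq_0_iff)
      have RL: "R \<subseteq> L" using L(3)[OF p b] unfolding R_def by auto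
      have "\<sigma> ` R \<subseteq> R" using RL s.rat_poly_root[OF mem] unfolding R_def by auto
      then have "\<sigma> ` R = R"
        by (intro endo_inj_surj fin inj_on_subset[OF inj RL])
      then show "b \<in> \<sigma> ` L" using p RL unfolding R_def by blast
    qed
  qed
  have rat: "\<sigma> q = q" if "q \<in> \<rat>" for q
    using that eq s.rat unfolding Rats_def by auto
  have "\<sigma> \<in> ring_iso (subfield_ring L) (subfield_ring L)"
    unfolding ring_iso_def ring_hom_def
    using in_L inj surj by (auto simp: ring_of_type_algebra_def bij_betw_def intro!: eq s.mult s.add s.one mem)
  moreover have "\<sigma> \<in> Bij L" using inj surj by (auto simp: Bij_def bij_betw_def \<sigma>_def)
  ultimately have "\<sigma> \<in> carrier (galois_group L)" unfolding galois_group_def using rat by simp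
  moreover have "\<forall>a b. (a, b) \<in> r \<longrightarrow> \<sigma> a = b" using s(1) eq by auto
  ultimately show ?thesis by blast
qed

section \<open>The field of all algebraic numbers and the Galois hull\<close>

abbreviation algebraic_numbers :: "complex set" where
  "algebraic_numbers \<equiv> {z. \<exists>p :: rat poly. p \<noteq> 0 \<and> poly (map_poly of_rat p) z = 0}"

lemma subfield_Rats: "subfield \<rat> complex_field"
  by (rule subfield_complexI) auto

lemma complex_field_UNIV: "subfield UNIV complex_field"
  by (rule subfield_complexI) auto

lemma Rats_list_of_rat: "set cs \<subseteq> \<rat> \<Longrightarrow> \<exists>rs. cs = map of_rat rs"
  by (induction cs) (auto simp: Rats_def, metis list.map(2))

lemma complex_field_simps:
  "carrier complex_field = UNIV" "\<one>\<^bsub>complex_field\<^esub> = 1" "\<zero>\<^bsub>complex_field\<^esub> = 0"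
  "a \<otimes>\<^bsub>complex_field\<^esub> b = a * b" "a \<oplus>\<^bsub>complex_field\<^esub> b = a + b"
  by (simp_all add: ring_of_type_algebra_def)

context
begin

interpretation complex_field: Ring.field complex_field
  by (rule field_from_type_algebra)

lemma complex_field_nat_pow: "(z :: complex) [^]\<^bsub>complex_field\<^esub> (n :: nat) = z ^ n"
  by (induction n) (simp_all add: complex_field_simps)

text \<open>In HOL-Algebra a polynomial is a list with its leading coefficient first, whereas
  \<open>Poly\<close> expects the constant term first; hence \<open>rev\<close>.\<close>

lemma complex_field_eval: "complex_field.eval (rev cs) z = poly (Poly cs) z"
  by (induction cs rule: rev_induct) (simp_all add: Poly_snoc poly_monom complex_field_nat_pow complex_field_simps)

text \<open>Links the two notions of algebraicity, so that closure of the algebraic elements under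
  field operations, and algebraicity from finite dimension, can be taken from HOL-Algebra.\<close>

lemma algebraic_numbers_eq: "(complex_field.algebraic over \<rat>) z \<longleftrightarrow> z \<in> algebraic_numbers"
proof
  assume "(complex_field.algebraic over \<rat>) z"
  then obtain p where p: "p \<in> carrier (univ_poly complex_field \<rat>)" "p \<noteq> []" "complex_field.eval p z = 0"
    using complex_field.algebraicE[OF subfieldE(1)[OF subfield_Rats]]
    by (auto simp: complex_field_simps)
  have set: "set (rev p) \<subseteq> \<rat>" and hd: "hd p \<noteq> 0"
    using p(1,2) by (auto simp: univ_poly_def polynomial_def ring_of_type_algebra_def)
  obtain rs where rs: "rev p = map of_rat rs" using Rats_list_of_rat[OF set] by blast
  have "rs \<noteq> []" using rs p(2) by auto
  moreover have "last rs \<noteq> 0" using hd rs \<open>rs \<noteq> []\<close> p(2)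
    by (metis hd_rev last_map of_rat_0 rev_rev_ident)
  ultimately have "nth_default 0 rs (length rs - 1) \<noteq> 0"
    by (simp add: nth_default_def last_conv_nth)
  then have "Poly rs \<noteq> 0" by (metis coeff_0 coeff_Poly_eq)
  moreover have "map_poly of_rat (Poly rs) = (Poly (map of_rat rs) :: complex poly)"
    by (intro poly_eqI) (simp add: coeff_map_poly nth_default_map_eq[of of_rat])
  then have "poly (map_poly of_rat (Poly rs)) z = 0"
    using p(3) complex_field_eval[of "rev p" z] rs by (metis rev_rev_ident)
  ultimately show "z \<in> algebraic_numbers" by blast
next
  assume "z \<in> algebraic_numbers"
  then obtain p :: "rat poly" where p: "p \<noteq> 0" "poly (map_poly of_rat p) z = 0" by blast
  define cs where "cs = coeffs (map_poly of_rat p :: complex poly)"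
  have nz: "(map_poly of_rat p :: complex poly) \<noteq> 0" using p by (simp add: map_poly_eq_0_iff)
  show "(complex_field.algebraic over \<rat>) z"
  proof (rule complex_field.algebraicI[of "rev cs"])
    show "rev cs \<noteq> []" using nz by (simp add: cs_def)
    have "hd (rev cs) \<noteq> 0" using nz by (simp add: cs_def hd_rev last_coeffs_eq_coeff_degree)
    moreover have "set cs \<subseteq> \<rat>" unfolding cs_def by (auto simp: coeffs_def coeff_map_poly)
    ultimately show "rev cs \<in> carrier (univ_poly complex_field \<rat>)"
      by (auto simp: univ_poly_def polynomial_def ring_of_type_algebra_def)
    show "complex_field.eval (rev cs) z = \<zero>\<^bsub>complex_field\<^esub>"
      unfolding complex_field_eval using p(2) by (simp add: cs_def complex_field_simps)
  qed
qed

text \<open>Provides a member of the family whose intersection is \<open>galois_hull\<close>.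
  Without a member the intersection would be the whole of the complex numbers; with this one the
  hull is algebraic.\<close>

lemma galois_algebraic_numbers: "galois_over_Q algebraic_numbers"
  unfolding galois_over_Q_def
proof (intro conjI ballI allI impI)
  have "{x. (complex_field.algebraic over \<rat>) x} = algebraic_numbers"
    using algebraic_numbers_eq by auto
  then show "subfield algebraic_numbers complex_field"
    using complex_field.subfield_of_algebraics[OF subfield_Rats] by (simp add: complex_field_simps)
next
  fix p :: "rat poly" and z :: complex
  assume "comm_semiring_1_class.irreducible p" "poly (map_poly of_rat p) z = 0"
  then show "z \<in> algebraic_numbers" by (intro CollectI exI[of _ p]) auto
qed auto

lemma number_field_algebraic:
  assumes "number_field_of_degree K n"
  shows "K \<subseteq> algebraic_numbers"
proof
  fix z assume "z \<in> K"
  have "subfield K complex_field" "complex_field.dimension n \<rat> K"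
    using assms unfolding number_field_of_degree_def by auto
  then have "(complex_field.algebraic over \<rat>) z"
    using complex_field.finite_dimension_imp_algebraic[OF subfield_Rats subfieldE(1) _ \<open>z \<in> K\<close>]
      complex_field.finite_dimensionI by blast
  then show "z \<in> algebraic_numbers" using algebraic_numbers_eq by blast
qed

end

lemma galois_galois_hull:
  assumes "K \<subseteq> algebraic_numbers"
  shows "galois_over_Q (galois_hull K)" and "K \<subseteq> galois_hull K"
proof -
  show K: "K \<subseteq> galois_hull K" unfolding galois_hull_def by auto
  have alg: "galois_hull K \<subseteq> algebraic_numbers"
    unfolding galois_hull_def using assms galois_algebraic_numbers by blast
  have "subfield (galois_hull K) complex_field"
    unfolding galois_hull_def galois_over_Q_def
    by (rule subfield_complexI) (auto dest: subfield_complexD)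
  moreover have "w \<in> galois_hull K" if "comm_semiring_1_class.irreducible p" "z \<in> galois_hull K"
    "poly (map_poly of_rat p) z = 0" "poly (map_poly of_rat p) w = 0" for p :: "rat poly" and z w
    using that galois_over_Q_D(3) unfolding galois_hull_def by blast
  ultimately show "galois_over_Q (galois_hull K)"
    unfolding galois_over_Q_def using alg by blast
qed

section \<open>Embeddings of a number field: rational values, normality and finiteness\<close>

lemma embeddings_D:
  assumes "x \<in> embeddings K"
  shows "x \<in> extensional K" "a \<in> K \<Longrightarrow> b \<in> K \<Longrightarrow> x (a + b) = x a + x b"
    "a \<in> K \<Longrightarrow> b \<in> K \<Longrightarrow> x (a * b) = x a * x b" "x 1 = 1"
  using assms unfolding embeddings_def by (auto simp: ring_hom_def ring_of_type_algebra_def)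

lemma embeddings_I:
  assumes "x \<in> extensional K" "\<And>a b. a \<in> K \<Longrightarrow> b \<in> K \<Longrightarrow> x (a + b) = x a + x b"
    "\<And>a b. a \<in> K \<Longrightarrow> b \<in> K \<Longrightarrow> x (a * b) = x a * x b" "x 1 = 1"
  shows "x \<in> embeddings K"
  using assms unfolding embeddings_def by (auto simp: ring_hom_def ring_of_type_algebra_def)

lemma subfield_hom_of_rat:
  assumes K: "subfield K complex_field"
    and add: "\<And>a b. a \<in> K \<Longrightarrow> b \<in> K \<Longrightarrow> x (a + b) = x a + x b"
    and mult: "\<And>a b. a \<in> K \<Longrightarrow> b \<in> K \<Longrightarrow> x (a * b) = x a * x b"
    and one: "x 1 = (1 :: complex)"
  shows "x (of_rat q) = of_rat q"
proof -
  note rat = of_rat_in_subfield[OF K] and K = subfield_complexD[OF K]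
  have zero: "x 0 = 0" using add[OF K(1,1)] by simp
  have neg: "x (- a) = - x a" if "a \<in> K" for a
    using add[OF that K(5)[OF that]] zero by (simp add: add_eq_0_iff)
  have natK: "of_nat n \<in> K" for n using rat[of "of_nat n"] by simp
  have intK: "of_int n \<in> K" for n using rat[of "of_int n"] by simp
  have nat: "x (of_nat n) = of_nat n" for n
    by (induction n) (use zero one add[OF K(2) natK] in auto)
  have int: "x (of_int k) = of_int k" for k
  proof (cases k)
    case (neg n)
    then have "of_int k = - (of_nat (Suc n) :: complex)" by simp
    then show ?thesis using \<open>\<And>a. a \<in> K \<Longrightarrow> x (- a) = - x a\<close>[OF natK] nat by metis
  qed (use nat in auto)
  obtain a b where ab: "q = Rat.Fract a b" "b > 0" by (cases q) auto
  then have "(of_rat q :: complex) * of_int b = of_int a" by (simp add: of_rat_rat)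
  then have "x (of_rat q) * of_int b = of_int a" using mult[OF rat intK] int by metis
  then show ?thesis using \<open>of_rat q * of_int b = of_int a\<close> ab(2)
    by (metis mult_right_cancel of_int_eq_0_iff order_less_irrefl)
qed

text \<open>This is the map y o x^(-1) on the image of \<open>x\<close>. Its extension to the Galois
  field carries \<open>x\<close> to \<open>y\<close>; with the inclusion as \<open>x\<close> it is
  the graph of \<open>y\<close> itself.\<close>

lemma partial_embedding_pair:
  assumes K: "subfield K complex_field" "K \<subseteq> algebraic_numbers"
    and x: "x \<in> embeddings K" and y: "y \<in> embeddings K"
  shows "partial_embedding {(x a, y a) | a. a \<in> K}" (is "partial_embedding ?r")
proof -
  note x = embeddings_D[OF x] and y = embeddings_D[OF y] and L = subfield_complexD[OF K(1)]
  have x0: "x 0 = 0" and y0: "y 0 = 0" using x(2)[OF L(1,1)] y(2)[OF L(1,1)] by auto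
  have xr: "x (of_rat q) = of_rat q" and yr: "y (of_rat q) = of_rat q" for q
    using subfield_hom_of_rat[OF K(1)] x y by metis+
  have inj: "a = 0" if "a \<in> K" "x a = 0" for a
  proof (rule ccontr)
    assume "a \<noteq> 0"
    then have "x a * x (Fields.inverse a) = 1" using x(3)[OF that(1) L(6)[OF that(1)]] x(4) by simp
    then show False using that by simp
  qed
  have poly_x: "poly (map_poly of_rat p) (x a) = x (poly (map_poly of_rat p) a)"
    and poly_K: "poly (map_poly of_rat p) a \<in> K" if "a \<in> K" for a and p :: "rat poly"
  proof -
    have "poly (map_poly of_rat p) a \<in> K \<and> poly (map_poly of_rat p) (x a) = x (poly (map_poly of_rat p) a)"
      using that by (induction p) (auto simp: map_poly_pCons x0 x xr L of_rat_in_subfield[OF K(1)])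
    then show "poly (map_poly of_rat p) (x a) = x (poly (map_poly of_rat p) a)"
      "poly (map_poly of_rat p) a \<in> K" by auto
  qed
  show ?thesis
  proof
    show "(of_rat q, of_rat q) \<in> ?r" for q
      using xr yr of_rat_in_subfield[OF K(1)] by (auto intro!: exI[of _ "of_rat q"])
  next
    fix a b a' b' assume "(a, b) \<in> ?r" "(a', b') \<in> ?r"
    then obtain u v where uv: "u \<in> K" "v \<in> K" "a = x u" "b = y u" "a' = x v" "b' = y v" by auto
    show "(a + a', b + b') \<in> ?r"
      using uv x(2) y(2) L(3) by (intro CollectI exI[of _ "u + v"]) auto
    show "(a * a', b * b') \<in> ?r"
      using uv x(3) y(3) L(4) by (intro CollectI exI[of _ "u * v"]) auto
  next
    fix b assume "(0, b) \<in> ?r"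
    then show "b = 0" using inj y0 by force
  next
    fix a b assume "(a, b) \<in> ?r"
    then obtain u where u: "u \<in> K" "a = x u" by auto
    then obtain p :: "rat poly" where "p \<noteq> 0" "poly (map_poly of_rat p) u = 0" using K(2) by auto
    then show "\<exists>p :: rat poly. p \<noteq> 0 \<and> poly (map_poly of_rat p) a = 0"
      using poly_x[OF u(1)] u x0 by auto
  qed
qed

lemma id_embedding: "subfield K complex_field \<Longrightarrow> restrict id K \<in> embeddings K"
  by (rule embeddings_I) (auto dest: subfield_complexD)

lemma embedding_graph:
  assumes K: "subfield K complex_field" "K \<subseteq> algebraic_numbers" and x: "x \<in> embeddings K"
  shows "partial_embedding {(a, x a) | a. a \<in> K}"
proof -
  have "{(a, x a) | a. a \<in> K} = {(restrict id K a, x a) | a. a \<in> K}" by auto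
  then show ?thesis using partial_embedding_pair[OF K id_embedding[OF K(1)] x] by simp
qed

lemma embedding_in_galois:
  assumes K: "subfield K complex_field" "K \<subseteq> L" and L: "galois_over_Q L"
    and x: "x \<in> embeddings K" and a: "a \<in> K"
  shows "x a \<in> L"
proof -
  note LD = galois_over_Q_D[OF L]
  have "K \<subseteq> algebraic_numbers" using K(2) LD(2) by auto
  then interpret r: partial_embedding "{(a, x a) | a. a \<in> K}"
    using embedding_graph[OF K(1) _ x] by blast
  obtain p where "comm_semiring_1_class.irreducible p" "poly (map_poly of_rat p) a = 0"
    using irreducible_rat_poly_root LD(2) K(2) a by blast
  then show ?thesis using r.rat_poly_root[of a "x a" p] LD(3)[of p a "x a"] a K(2) by blast
qed

text \<open>An embedding is determined by its values on a finite spanning set, and each value is a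
  root of a fixed nonzero rational polynomial, so finitely many value tables occur.\<close>

lemma finite_embeddings:
  assumes "number_field_of_degree K n"
  shows "finite (embeddings K)"
proof -
  have K: "subfield K complex_field" "ring.dimension complex_field n \<rat> K" "K \<subseteq> algebraic_numbers"
    using assms number_field_algebraic[OF assms] unfolding number_field_of_degree_def by auto
  interpret complex_field: Ring.field complex_field by (rule field_from_type_algebra)
  note KD = subfield_complexD[OF K(1)]
  define determines where "determines = (\<lambda>B E.
      \<forall>x\<in>embeddings K. \<forall>y\<in>embeddings K. (\<forall>b\<in>B. x b = y b) \<longrightarrow> (\<forall>z\<in>E. x z = y z))"
  \<comment> \<open>The induction runs through subspaces of \<open>K\<close>. Carrying
    \<open>0 \<in> E\<close> lets both \<open>v\<close> and the elements of \<open>E\<close> be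
    recognised inside the line extension, as 1 v + 0 and 0 v + e; containment in \<open>K\<close> is
    what makes additivity and multiplicativity applicable.\<close>
  have "0 \<in> E \<and> (E \<subseteq> K \<longrightarrow> (\<exists>B. finite B \<and> B \<subseteq> K \<and> determines B E))"
    if "complex_field.dimension n \<rat> E" for n E
    using that
  proof (induction n "\<rat> :: complex set" E rule: complex_field.dimension.induct)
    case zero_dim
    have zero: "\<zero>\<^bsub>complex_field\<^esub> = 0" by (simp add: complex_field_simps)
    have "x 0 = 0" if "x \<in> embeddings K" for x
      using embeddings_D(2)[OF that KD(1,1)] by simp
    then have "determines {} {0}" unfolding determines_def by (metis singletonD)
    then show ?case unfolding zero by blast
  next
    case (Suc_dim v E n)
    have line: "complex_field.line_extension \<rat> v E = {k * v + e | k e. k \<in> \<rat> \<and> e \<in> E}"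
      unfolding complex_field.line_extension_def by (auto simp: set_add_def' r_coset_def complex_field_simps)
    have E0: "0 \<in> E" using Suc_dim by blast
    have "0 \<in> complex_field.line_extension \<rat> v E"
      unfolding line using E0 by (intro CollectI exI[of _ 0]) auto
    moreover have "\<exists>B. finite B \<and> B \<subseteq> K \<and> determines B (complex_field.line_extension \<rat> v E)"
      if sub: "complex_field.line_extension \<rat> v E \<subseteq> K"
    proof -
      have "k * v + e \<in> K" if "k \<in> \<rat>" "e \<in> E" for k e using that sub unfolding line by blast
      from this[of 1 0] this[of 0] have vK: "v \<in> K" and EK: "E \<subseteq> K" using E0 by auto
      obtain B where B: "finite B" "B \<subseteq> K" "determines B E"
        using Suc_dim EK by blast
      have "x (k * v + e) = y (k * v + e)" if "x \<in> embeddings K" "y \<in> embeddings K"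
        "\<forall>b\<in>insert v B. x b = y b" "k \<in> \<rat>" "e \<in> E" for x y k e
      proof -
        obtain q where q: "k = of_rat q" using \<open>k \<in> \<rat>\<close> by (auto simp: Rats_def)
        have k: "k \<in> K" "x k = y k"
          unfolding q using of_rat_in_subfield[OF K(1)] subfield_hom_of_rat[OF K(1)] embeddings_D that(1,2)
          by metis+
        show ?thesis
          using embeddings_D(2,3)[OF that(1)] embeddings_D(2,3)[OF that(2)] k vK KD(4) EK that B(3)
          unfolding determines_def by (auto simp: subset_iff)
      qed
      then have "determines (insert v B) (complex_field.line_extension \<rat> v E)"
        unfolding determines_def line by blast
      then show ?thesis using B vK by (intro exI[of _ "insert v B"]) blast
    qed
    ultimately show ?case by blast
  qed
  then obtain B where B: "finite B" "B \<subseteq> K" "determines B K"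
    using K(2) by blast
  have "\<forall>b\<in>B. \<exists>p :: rat poly. p \<noteq> 0 \<and> poly (map_poly of_rat p) b = 0"
    using B K(3) by blast
  then obtain p :: "complex \<Rightarrow> rat poly" where p: "\<And>b. b \<in> B \<Longrightarrow> p b \<noteq> 0 \<and> poly (map_poly of_rat (p b)) b = 0"
    by metis
  define T where "T = (\<Pi>\<^sub>E b\<in>B. {z :: complex. poly (map_poly of_rat (p b)) z = 0})"
  have "finite T" unfolding T_def using p
    by (intro finite_PiE B poly_roots_finite) (auto simp: map_poly_eq_0_iff)
  moreover have "(\<lambda>x. restrict x B) ` embeddings K \<subseteq> T"
  proof -
    have "poly (map_poly of_rat (p b)) (x b) = 0" if "x \<in> embeddings K" "b \<in> B" for x b
    proof -
      interpret r: partial_embedding "{(a, x a) | a. a \<in> K}"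
        by (rule embedding_graph[OF K(1,3) that(1)])
      show ?thesis using r.rat_poly_root[of b "x b" "p b"] p[OF that(2)] B(2) that by blast
    qed
    then show ?thesis unfolding T_def by auto
  qed
  moreover have "inj_on (\<lambda>x. restrict x B) (embeddings K)"
  proof (rule inj_onI)
    fix x y assume xy: "x \<in> embeddings K" "y \<in> embeddings K" "restrict x B = restrict y B"
    then have "\<forall>b\<in>B. x b = y b" by (metis restrict_apply')
    then have "x z = y z" if "z \<in> K" for z using B(3) xy(1,2) that unfolding determines_def by blast
    then show "x = y" using embeddings_D(1) xy(1,2) by (metis extensionalityI)
  qed
  ultimately show ?thesis using finite_subset inj_on_finite by blast
qed

section \<open>The action of the Galois group on embeddings\<close>

lemma galois_group_D:
  assumes "\<sigma> \<in> carrier (galois_group L)"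
  shows "\<sigma> \<in> Bij L" "\<sigma> \<in> extensional L" "bij_betw \<sigma> L L" "a \<in> L \<Longrightarrow> \<sigma> a \<in> L" "\<sigma> 1 = 1"
    "a \<in> L \<Longrightarrow> b \<in> L \<Longrightarrow> \<sigma> (a + b) = \<sigma> a + \<sigma> b" "a \<in> L \<Longrightarrow> b \<in> L \<Longrightarrow> \<sigma> (a * b) = \<sigma> a * \<sigma> b"
    "\<sigma> (of_rat q) = of_rat q"
  using assms unfolding galois_group_def
  by (auto simp: Bij_def ring_iso_def ring_hom_def ring_of_type_algebra_def bij_betw_apply)

lemma galois_group_I:
  assumes "subfield L complex_field" "\<sigma> \<in> extensional L" "bij_betw \<sigma> L L" "\<sigma> 1 = 1"
    "\<And>a b. a \<in> L \<Longrightarrow> b \<in> L \<Longrightarrow> \<sigma> (a + b) = \<sigma> a + \<sigma> b"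
    "\<And>a b. a \<in> L \<Longrightarrow> b \<in> L \<Longrightarrow> \<sigma> (a * b) = \<sigma> a * \<sigma> b"
  shows "\<sigma> \<in> carrier (galois_group L)"
  using assms bij_betw_apply[OF assms(3)] subfield_hom_of_rat[OF assms(1,5,6,4)] unfolding galois_group_def
  by (auto simp: Bij_def ring_iso_def ring_hom_def ring_of_type_algebra_def Rats_def)

lemma galois_group_mult:
  assumes "\<sigma> \<in> carrier (galois_group L)" "\<rho> \<in> carrier (galois_group L)"
  shows "\<sigma> \<otimes>\<^bsub>galois_group L\<^esub> \<rho> = compose L \<sigma> \<rho>"
  using galois_group_D(1)[OF assms(1)] galois_group_D(1)[OF assms(2)]
  by (simp add: galois_group_def BijGroup_def)

lemma galois_group_compose:
  assumes "subfield L complex_field"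
    and s: "\<sigma> \<in> carrier (galois_group L)" and r: "\<rho> \<in> carrier (galois_group L)"
  shows "compose L \<sigma> \<rho> \<in> carrier (galois_group L)"
proof (rule galois_group_I[OF assms(1)])
  note L = subfield_complexD[OF assms(1)] and s = galois_group_D[OF s] and r = galois_group_D[OF r]
  show "bij_betw (compose L \<sigma> \<rho>) L L" using bij_betw_compose s r by blast
  show "compose L \<sigma> \<rho> (a + b) = compose L \<sigma> \<rho> a + compose L \<sigma> \<rho> b"
    "compose L \<sigma> \<rho> (a * b) = compose L \<sigma> \<rho> a * compose L \<sigma> \<rho> b" if "a \<in> L" "b \<in> L" for a b
    using that L s r by (simp_all add: compose_eq)
  show "compose L \<sigma> \<rho> 1 = 1" using L s r by (simp add: compose_eq)
qed simp

lemma galois_group_inverse: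
  assumes "subfield L complex_field" and s: "\<sigma> \<in> carrier (galois_group L)"
  shows "restrict (inv_into L \<sigma>) L \<in> carrier (galois_group L)"
proof (rule galois_group_I[OF assms(1)])
  note L = subfield_complexD[OF assms(1)] and s = galois_group_D[OF s]
  have inj: "inj_on \<sigma> L" and im: "\<sigma> ` L = L" using s(3) by (auto simp: bij_betw_def)
  have inv: "inv_into L \<sigma> b \<in> L" "\<sigma> (inv_into L \<sigma> b) = b" if "b \<in> L" for b
    using that im by (auto simp: inv_into_into f_inv_into_f)
  have eqI: "inv_into L \<sigma> b = a" if "a \<in> L" "\<sigma> a = b" for a b
    using inv_into_f_f[OF inj that(1)] that by simp
  show "bij_betw (restrict (inv_into L \<sigma>) L) L L" using bij_betw_inv_into[OF s(3)] by simp
  show "restrict (inv_into L \<sigma>) L (a + b) = restrict (inv_into L \<sigma>) L a + restrict (inv_into L \<sigma>) L b"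
    "restrict (inv_into L \<sigma>) L (a * b) = restrict (inv_into L \<sigma>) L a * restrict (inv_into L \<sigma>) L b"
    if "a \<in> L" "b \<in> L" for a b
    using that L s(6,7) inv by (auto intro!: eqI)
  show "restrict (inv_into L \<sigma>) L 1 = 1" using L s(5) by (auto intro!: eqI)
qed simp

lemma group_galois_group:
  assumes "subfield L complex_field"
  shows "group (galois_group L)"
proof (rule groupI)
  note L = subfield_complexD[OF assms]
  have one: "\<one>\<^bsub>galois_group L\<^esub> = restrict id L"
    by (simp add: galois_group_def BijGroup_def id_def)
  show id: "\<one>\<^bsub>galois_group L\<^esub> \<in> carrier (galois_group L)"
    unfolding one by (rule galois_group_I[OF assms]) (auto simp: L bij_betw_def inj_on_def)
  fix x assume x: "x \<in> carrier (galois_group L)"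
  note xD = galois_group_D[OF x]
  show "\<one>\<^bsub>galois_group L\<^esub> \<otimes>\<^bsub>galois_group L\<^esub> x = x"
    unfolding galois_group_mult[OF id x] unfolding one using xD(2,4)
    by (auto simp: compose_def extensional_def fun_eq_iff)
  have i: "restrict (inv_into L x) L \<in> carrier (galois_group L)"
    by (rule galois_group_inverse[OF assms x])
  have "restrict (inv_into L x) L \<otimes>\<^bsub>galois_group L\<^esub> x = \<one>\<^bsub>galois_group L\<^esub>"
    unfolding galois_group_mult[OF i x] unfolding one using Bij_compose_restrict_eq[OF xD(1)] by (simp add: id_def)
  then show "\<exists>y\<in>carrier (galois_group L). y \<otimes>\<^bsub>galois_group L\<^esub> x = \<one>\<^bsub>galois_group L\<^esub>" using i by blast
  fix y assume y: "y \<in> carrier (galois_group L)"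
  show xy: "x \<otimes>\<^bsub>galois_group L\<^esub> y \<in> carrier (galois_group L)"
    unfolding galois_group_mult[OF x y] by (rule galois_group_compose[OF assms x y])
  fix z assume z: "z \<in> carrier (galois_group L)"
  show "x \<otimes>\<^bsub>galois_group L\<^esub> y \<otimes>\<^bsub>galois_group L\<^esub> z = x \<otimes>\<^bsub>galois_group L\<^esub> (y \<otimes>\<^bsub>galois_group L\<^esub> z)"
    using x y z galois_group_compose[OF assms] galois_group_D(4)[OF z]
    by (auto simp: galois_group_mult compose_def fun_eq_iff)
qed

lemma galois_group_inv:
  assumes "subfield L complex_field" "\<sigma> \<in> carrier (galois_group L)" "a \<in> L"
  shows "\<sigma> ((inv\<^bsub>galois_group L\<^esub> \<sigma>) a) = a" "(inv\<^bsub>galois_group L\<^esub> \<sigma>) (\<sigma> a) = a"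
proof -
  interpret group "galois_group L" by (rule group_galois_group[OF assms(1)])
  have i: "inv\<^bsub>galois_group L\<^esub> \<sigma> \<in> carrier (galois_group L)" using assms(2) by simp
  have one: "\<one>\<^bsub>galois_group L\<^esub> = restrict id L"
    by (simp add: galois_group_def BijGroup_def id_def)
  show "\<sigma> ((inv\<^bsub>galois_group L\<^esub> \<sigma>) a) = a"
    using r_inv[OF assms(2)] assms(3) unfolding galois_group_mult[OF assms(2) i] one
    by (metis compose_eq restrict_apply' id_apply)
  show "(inv\<^bsub>galois_group L\<^esub> \<sigma>) (\<sigma> a) = a"
    using l_inv[OF assms(2)] assms(3) unfolding galois_group_mult[OF i assms(2)] one
    by (metis compose_eq restrict_apply' id_apply)
qed

lemma galois_group_graph:
  assumes "galois_over_Q L" "\<sigma> \<in> carrier (galois_group L)"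
  shows "partial_embedding {(a, \<sigma> a) | a. a \<in> L}"
proof (rule embedding_graph)
  note s = galois_group_D[OF assms(2)]
  show "subfield L complex_field" "L \<subseteq> algebraic_numbers" using galois_over_Q_D[OF assms(1)] by auto
  show "\<sigma> \<in> embeddings L" by (rule embeddings_I) (use s in auto)
qed

text \<open>Complex conjugation fixes rational coefficients, so it permutes the roots of each
  rational polynomial; normality then keeps it inside \<open>L\<close>.\<close>

lemma galois_cnj:
  assumes "galois_over_Q L"
  shows "restricted_conjugation L \<in> carrier (galois_group L)"
proof -
  note L = galois_over_Q_D[OF assms]
  note LD = subfield_complexD[OF L(1)]
  have cnj_rat: "cnj (of_rat q) = of_rat q" for q
    using subfield_hom_of_rat[OF complex_field_UNIV, of cnj] by simp
  have cnj_poly: "poly (map_poly of_rat p) (cnj z) = cnj (poly (map_poly of_rat p) z)" for p z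
    by (induction p) (auto simp: map_poly_pCons cnj_rat)
  have in_L: "cnj a \<in> L" if a: "a \<in> L" for a
  proof -
    obtain p where p: "comm_semiring_1_class.irreducible p" "poly (map_poly of_rat p) a = 0"
      using irreducible_rat_poly_root L(2)[OF a] by blast
    show ?thesis using L(3)[OF p a, of "cnj a"] cnj_poly[of p a] p(2) by simp
  qed
  show ?thesis unfolding restricted_conjugation_def
  proof (rule galois_group_I[OF L(1)])
    have "cnj ` L = L" using in_L by (auto simp: image_iff) (metis complex_cnj_cnj)
    then show "bij_betw (restrict cnj L) L L" by (auto simp: bij_betw_def inj_on_def)
  qed (use LD in auto)
qed

text \<open>Any root \<open>b\<close> of the minimal polynomial \<open>m\<close> of \<open>z\<close>
  over the rationals is the image of \<open>z\<close> under some automorphism, so \<open>z\<close>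
  is the only root and \<open>m\<close> is a power of X - z. In characteristic zero its second
  coefficient already determines \<open>z\<close>.\<close>

lemma fixed_rational:
  assumes L: "galois_over_Q L" and z: "z \<in> L"
    and fixed: "\<And>\<sigma>. \<sigma> \<in> carrier (galois_group L) \<Longrightarrow> \<sigma> z = z"
  shows "z \<in> \<rat>"
proof -
  note LD = galois_over_Q_D[OF L]
  \<comment> \<open>The identity on the rationals as a partial embedding: its minimal pair is the
    minimal polynomial over the rationals, taken twice.\<close>
  define r where "r = {(a :: complex, a) | a. a \<in> \<rat>}"
  interpret r: partial_embedding r
  proof
    fix a b assume "(a, b) \<in> r"
    then obtain q where "a = of_rat q" unfolding r_def by (auto simp: Rats_def)
    then show "\<exists>p :: rat poly. p \<noteq> 0 \<and> poly (map_poly of_rat p) a = 0"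
      by (intro exI[of _ "[:-q, 1:]"]) (simp add: map_poly_pCons of_rat_minus)
  qed (auto simp: r_def)
  obtain p0 :: "rat poly" where p0: "p0 \<noteq> 0" "poly (map_poly of_rat p0) z = 0" using LD(2)[OF z] by blast
  obtain m m' where m: "r.poly_rel m m'" "poly m z = 0" "Polynomial.lead_coeff m = 1"
    "Polynomial.lead_coeff m' = 1" "Polynomial.degree m' = Polynomial.degree m"
    "Polynomial.degree m > 0"
    "\<And>p q. r.poly_rel p q \<Longrightarrow> p \<noteq> 0 \<Longrightarrow> poly p z = 0 \<Longrightarrow> Polynomial.degree m \<le> Polynomial.degree p"
    using r.minimal_poly_rel[OF p0] by blast
  have r_iff: "(a, b) \<in> r \<longleftrightarrow> a = b \<and> a \<in> \<rat>" for a b unfolding r_def by auto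
  have m_rat: "poly.coeff m i = poly.coeff m' i" "poly.coeff m i \<in> \<rat>" for i
    using m(1) unfolding r.poly_rel_def r_iff by blast+
  have mm: "m' = m" by (intro poly_eqI) (simp add: m_rat(1))
  have only_root: "b = z" if b: "poly m b = 0" for b
  proof -
    have in_L: "poly p z \<in> L" if "r.poly_rel p q" for p q
    proof (rule subfield_poly_mem[OF LD(1) z])
      fix i
      have "poly.coeff p i \<in> \<rat>" using that unfolding r.poly_rel_def r_iff by blast
      then show "poly.coeff p i \<in> L" using of_rat_in_subfield[OF LD(1)] by (auto simp: Rats_def)
    qed
    have b': "poly m' b = 0" using b mm by simp
    have emb: "partial_embedding (r.adjoin z b)"
      by (rule r.partial_embedding_adjoin[OF LD(2)[OF in_L] r.poly_rel_root[OF m(1,2,3,6,7) b']])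
    have dom: "Domain (r.adjoin z b) \<subseteq> L"
      unfolding r.adjoin_def using in_L by blast
    obtain \<sigma> where "\<sigma> \<in> carrier (galois_group L)" "\<sigma> z = b"
      using galois_group_extends[OF L emb dom] r.mem_adjoin by blast
    then show "b = z" using fixed by metis
  qed
  have "m \<noteq> 0" using m(6) by auto
  define j where "j = Polynomial.order z m"
  obtain q where q: "m = [:-z, 1:] ^ j * q" "\<not> [:-z, 1:] dvd q"
    using order_decomp[OF \<open>m \<noteq> 0\<close>] unfolding j_def by blast
  have "\<not> (\<exists>b. poly q b = 0)"
    using q only_root by (metis mult_zero_right poly_eq_0_iff_dvd poly_mult)
  then have "Polynomial.degree q = 0"
    using fundamental_theorem_of_algebra constant_degree by metis
  then obtain c where c: "q = [:c:]" by (metis degree_eq_zeroE)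
  have j0: "j > 0" using \<open>m \<noteq> 0\<close> m(2) unfolding j_def by (simp add: order_gt_0_iff)
  have "Polynomial.lead_coeff m = c" unfolding q(1) c lead_coeff_mult lead_coeff_power by simp
  then have "c = 1" using m(3) by simp
  then have "m = [:-z, 1:] ^ j" using q c by simp
  \<comment> \<open>In (X - z)^j the coefficient of X^(j-1) is -j z; division by -j is possible
    since j > 0.\<close>
  then have "poly.coeff m (j - 1) = of_nat j * (- z)"
    using j0 binomial_symmetric[of "j - 1" j] by (simp add: coeff_linear_poly_power)
  then have "of_nat j * (- z) \<in> \<rat>" using m_rat(2) by metis
  then have "of_nat j * (- z) / (- of_nat j) \<in> \<rat>" by (intro Rats_divide) auto
  moreover have "of_nat j * (- z) / (- of_nat j) = z" using j0 by simp
  ultimately show ?thesis by metis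
qed

section \<open>The action on the set of embeddings and the orbits M_tau(x)\<close>

locale galois_embeddings =
  fixes K L :: "complex set"
  assumes K: "subfield K complex_field" and KL: "K \<subseteq> L" and L: "galois_over_Q L"
    and fin: "finite (embeddings K)"
begin

lemma subfield_L: "subfield L complex_field"
  using galois_over_Q_D(1)[OF L] .

lemma K_algebraic: "K \<subseteq> algebraic_numbers"
  using KL galois_over_Q_D(2)[OF L] by auto

lemma embedding_mem: "x \<in> embeddings K \<Longrightarrow> a \<in> K \<Longrightarrow> x a \<in> L"
  using embedding_in_galois[OF K KL L] .

lemma act_embedding:
  assumes s: "\<sigma> \<in> carrier (galois_group L)" and x: "x \<in> embeddings K"
  shows "compose K \<sigma> x \<in> embeddings K"
proof (rule embeddings_I)
  note KD = subfield_complexD[OF K] and x' = embeddings_D[OF x] embedding_mem[OF x] and s' = galois_group_D[OF s]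
  show "compose K \<sigma> x (a + b) = compose K \<sigma> x a + compose K \<sigma> x b"
    "compose K \<sigma> x (a * b) = compose K \<sigma> x a * compose K \<sigma> x b" if "a \<in> K" "b \<in> K" for a b
    using that KD x' s' by (simp_all add: compose_eq)
  show "compose K \<sigma> x 1 = 1" using KD x' s' by (simp add: compose_eq)
qed simp

text \<open>Injectivity is inherited from \<open>\<sigma>\<close>, and surjectivity follows because
  the set of embeddings is finite.\<close>

lemma act_bij:
  assumes s: "\<sigma> \<in> carrier (galois_group L)"
  shows "bij_betw (compose K \<sigma>) (embeddings K) (embeddings K)"
proof -
  have "inj_on (compose K \<sigma>) (embeddings K)"
  proof (rule inj_onI)
    fix x y assume xy: "x \<in> embeddings K" "y \<in> embeddings K" "compose K \<sigma> x = compose K \<sigma> y"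
    have "x a = y a" if "a \<in> K" for a
      using galois_group_D(3)[OF s] embedding_mem[OF xy(1) that] embedding_mem[OF xy(2) that]
        fun_cong[OF xy(3), of a] that by (auto simp: compose_eq bij_betw_def inj_on_def)
    then show "x = y" using embeddings_D(1) xy(1,2) by (metis extensionalityI)
  qed
  then show ?thesis
    using endo_inj_surj[OF fin] act_embedding[OF s] unfolding bij_betw_def by (simp add: image_subsetI)
qed

lemma act_transitive:
  assumes "x \<in> embeddings K" "y \<in> embeddings K"
  shows "\<exists>\<sigma>\<in>carrier (galois_group L). compose K \<sigma> x = y"
proof -
  have dom: "Domain {(x a, y a) | a. a \<in> K} \<subseteq> L" using embedding_mem[OF assms(1)] by auto
  obtain \<sigma> where s: "\<sigma> \<in> carrier (galois_group L)"
    and eq: "\<forall>u v. (u, v) \<in> {(x a, y a) | a. a \<in> K} \<longrightarrow> \<sigma> u = v"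
    using galois_group_extends[OF L partial_embedding_pair[OF K K_algebraic assms] dom] by (elim bexE)
  have "\<sigma> (x a) = y a" if "a \<in> K" for a
    using eq that by blast
  then have "compose K \<sigma> x = y"
    by (intro extensionalityI[of _ K]) (use embeddings_D(1)[OF assms(2)] in \<open>auto simp: compose_eq\<close>)
  then show ?thesis using s by blast
qed

lemma act_compose:
  assumes "x \<in> embeddings K"
  shows "compose K (compose L \<sigma> \<rho>) x = compose K \<sigma> (compose K \<rho> x)"
  using embedding_mem[OF assms] by (auto simp: compose_def fun_eq_iff)

lemma act_restricted_conjugation:
  assumes "x \<in> embeddings K"
  shows "compose K (restricted_conjugation L) x = compose K cnj x"
  using embedding_mem[OF assms] by (auto simp: compose_def fun_eq_iff restricted_conjugation_def)

lemma cnj_embedding: "x \<in> embeddings K \<Longrightarrow> compose K cnj x \<in> embeddings K"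
  using act_embedding[OF galois_cnj[OF L]] by (simp flip: act_restricted_conjugation)

abbreviation orbit :: "(complex \<Rightarrow> complex) \<Rightarrow> (complex \<Rightarrow> complex) set" where
  "orbit \<equiv> conjugate_orbit (galois_group L) (embedding_action K) (restricted_conjugation L)"

text \<open>Substituting z = \<open>\<sigma>\<close>^(-1) x turns conjugates of complex conjugation
  into translates: the pairs (x, y) with y in the orbit of x are the Galois images of the pairs (z,
  conjugate of z). A zero known at the real point of z can thus be transported to the lines of x and
  y.\<close>

lemma orbit_iff:
  assumes x: "x \<in> embeddings K"
  shows "y \<in> orbit x \<longleftrightarrow> (\<exists>\<sigma>\<in>carrier (galois_group L). \<exists>z\<in>embeddings K.
    x = compose K \<sigma> z \<and> y = compose K \<sigma> (compose K cnj z))"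
proof -
  interpret G: group "galois_group L" by (rule group_galois_group[OF subfield_L])
  note cnj = galois_cnj[OF L]
  have eq: "embedding_action K (\<sigma> \<otimes>\<^bsub>galois_group L\<^esub> restricted_conjugation L \<otimes>\<^bsub>galois_group L\<^esub> inv\<^bsub>galois_group L\<^esub> \<sigma>) x
    = compose K \<sigma> (compose K cnj (compose K (inv\<^bsub>galois_group L\<^esub> \<sigma>) x))"
    if s: "\<sigma> \<in> carrier (galois_group L)" for \<sigma>
  proof -
    have ix: "compose K (inv\<^bsub>galois_group L\<^esub> \<sigma>) x \<in> embeddings K"
      using act_embedding x s by simp
    show ?thesis
      using x s cnj ix act_embedding[OF cnj ix] unfolding embedding_action_def
      by (simp add: galois_group_mult galois_group_compose[OF subfield_L] act_compose act_restricted_conjugation)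
  qed
  have inv: "compose K \<sigma> (compose K (inv\<^bsub>galois_group L\<^esub> \<sigma>) w) = w" "compose K (inv\<^bsub>galois_group L\<^esub> \<sigma>) (compose K \<sigma> w) = w"
    if "\<sigma> \<in> carrier (galois_group L)" "w \<in> embeddings K" for \<sigma> w
    using that embedding_mem[OF that(2)] embeddings_D(1)[OF that(2)] galois_group_inv[OF subfield_L that(1)]
    by (auto simp: compose_def fun_eq_iff extensional_def)
  show ?thesis
  proof
    assume "y \<in> orbit x"
    then obtain \<sigma> where s: "\<sigma> \<in> carrier (galois_group L)"
      and y: "y = compose K \<sigma> (compose K cnj (compose K (inv\<^bsub>galois_group L\<^esub> \<sigma>) x))"
      unfolding conjugate_orbit_def using eq by auto
    show "\<exists>\<sigma>\<in>carrier (galois_group L). \<exists>z\<in>embeddings K.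
      x = compose K \<sigma> z \<and> y = compose K \<sigma> (compose K cnj z)"
      using s y inv(1)[OF s x] act_embedding[OF G.inv_closed[OF s] x] by metis
  next
    assume "\<exists>\<sigma>\<in>carrier (galois_group L). \<exists>z\<in>embeddings K.
      x = compose K \<sigma> z \<and> y = compose K \<sigma> (compose K cnj z)"
    then obtain \<sigma> z where s: "\<sigma> \<in> carrier (galois_group L)" and z: "z \<in> embeddings K"
      and xy: "x = compose K \<sigma> z" "y = compose K \<sigma> (compose K cnj z)" by blast
    have "y = embedding_action K (\<sigma> \<otimes>\<^bsub>galois_group L\<^esub> restricted_conjugation L \<otimes>\<^bsub>galois_group L\<^esub> inv\<^bsub>galois_group L\<^esub> \<sigma>) x"
      unfolding eq[OF s] using xy inv(2)[OF s z] by simp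
    then show "y \<in> orbit x" unfolding conjugate_orbit_def using s by blast
  qed
qed

lemma orbit_subset:
  assumes "x \<in> embeddings K"
  shows "orbit x \<subseteq> embeddings K"
proof
  fix y assume "y \<in> orbit x"
  then show "y \<in> embeddings K"
    unfolding orbit_iff[OF assms] by (auto intro: act_embedding cnj_embedding)
qed

text \<open>If x is moved to y by \<open>\<rho>\<close>, then replacing \<open>\<sigma>\<close> by
  the composite of \<open>\<rho>\<close> and \<open>\<sigma>\<close> sends the orbit of x into that
  of y. Applied in both directions this gives the constancy on which the \<open>THE\<close> in
  \<open>characteristic_number\<close> rests.\<close>

lemma card_orbit_le:
  assumes "x \<in> embeddings K" "y \<in> embeddings K"
  shows "card (orbit x) \<le> card (orbit y)"
proof -
  obtain \<rho> where r: "\<rho> \<in> carrier (galois_group L)" and y: "compose K \<rho> x = y"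
    using act_transitive[OF assms] by blast
  have "compose K \<rho> ` orbit x \<subseteq> orbit y"
  proof (rule image_subsetI)
    fix w assume "w \<in> orbit x"
    then obtain \<sigma> z where s: "\<sigma> \<in> carrier (galois_group L)" and z: "z \<in> embeddings K"
      and xw: "x = compose K \<sigma> z" "w = compose K \<sigma> (compose K cnj z)"
      using orbit_iff[OF assms(1)] by blast
    have "y = compose K (compose L \<rho> \<sigma>) z" "compose K \<rho> w = compose K (compose L \<rho> \<sigma>) (compose K cnj z)"
      using act_compose[OF z] act_compose[OF cnj_embedding[OF z]] xw y by metis+
    then show "compose K \<rho> w \<in> orbit y"
      using orbit_iff[OF assms(2)] galois_group_compose[OF subfield_L r s] z by blast
  qed
  moreover have "inj_on (compose K \<rho>) (orbit x)"
    using inj_on_subset[OF _ orbit_subset[OF assms(1)]] act_bij[OF r] unfolding bij_betw_def by blast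
  ultimately show ?thesis
    using finite_subset[OF orbit_subset[OF assms(2)] fin] by (intro card_inj_on_le)
qed

lemma characteristic_number_eq:
  assumes "x \<in> embeddings K"
  shows "characteristic_number (galois_group L) (embeddings K) (embedding_action K) (restricted_conjugation L)
    = card (orbit x)"
  unfolding characteristic_number_def
proof (rule the_equality)
  show eq: "\<forall>y\<in>embeddings K. card (orbit y) = card (orbit x)"
    using card_orbit_le[OF assms] card_orbit_le[OF _ assms] by (simp add: le_antisym)
  show "c = card (orbit x)" if "\<forall>y\<in>embeddings K. card (orbit y) = c" for c
    using that assms by simp
qed

text \<open>Cancelling \<open>\<sigma>\<close> would leave an embedding equal to its own complex
  conjugate, that is, a real place.\<close>

lemma not_mem_orbit:
  assumes "totally_imaginary K" "x \<in> embeddings K"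
  shows "x \<notin> orbit x"
proof
  assume "x \<in> orbit x"
  then obtain \<sigma> z where s: "\<sigma> \<in> carrier (galois_group L)" and z: "z \<in> embeddings K"
    and x: "x = compose K \<sigma> z" "x = compose K \<sigma> (compose K cnj z)"
    using orbit_iff[OF assms(2)] by blast
  then have "compose K cnj z = z"
    using act_bij[OF s] cnj_embedding[OF z] by (auto simp: bij_betw_def inj_on_def)
  then have "cnj (z a) = z a" if "a \<in> K" for a using that by (metis compose_eq)
  then have "z ` K \<subseteq> \<real>" by (auto simp: Reals_cnj_iff)
  then show False using assms(1) z unfolding totally_imaginary_def by blast
qed

end

section \<open>Ternary forms and linear forms in general position\<close>

definition mon :: "(3 \<Rightarrow>\<^sub>0 nat) \<Rightarrow> 'a::comm_semiring_1 ^ 3 \<Rightarrow> 'a" where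
  "mon m v = (\<Prod>i\<in>UNIV. (v $ i) ^ Poly_Mapping.lookup m i)"

lemma mon_0 [simp]: "mon 0 v = 1"
  by (simp add: mon_def)

lemma mon_add: "mon (m + n) v = mon m v * mon n v"
  by (simp add: mon_def lookup_add power_add prod.distrib)

lemma mon_scale: "mon m (t *s v) = t ^ monom_degree m * mon m v"
  by (simp add: mon_def monom_degree_def power_mult_distrib prod.distrib power_sum)

text \<open>The coefficient map \<open>h\<close> lets one rational polynomial be evaluated at real
  and at complex vectors, with \<open>of_rat\<close> as \<open>h\<close>; \<open>eval3\<close> is
  the case \<open>id\<close>.\<close>

definition peval :: "('b::zero \<Rightarrow> 'a::comm_semiring_1) \<Rightarrow> 'b mpoly3 \<Rightarrow> 'a ^ 3 \<Rightarrow> 'a" where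
  "peval h p v = (\<Sum>m\<in>Poly_Mapping.keys p. h (Poly_Mapping.lookup p m) * mon m v)"

lemma eval3_eq_peval: "eval3 p v = peval id p v"
  by (simp add: eval3_def peval_def mon_def)

lemma peval_superset:
  assumes "finite A" "Poly_Mapping.keys p \<subseteq> A" "h 0 = 0"
  shows "peval h p v = (\<Sum>m\<in>A. h (Poly_Mapping.lookup p m) * mon m v)"
  unfolding peval_def by (rule sum.mono_neutral_left) (use assms in \<open>auto simp: in_keys_iff\<close>)

lemma lookup_map: "f 0 = 0 \<Longrightarrow> Poly_Mapping.lookup (Poly_Mapping.map f p) m = f (Poly_Mapping.lookup p m)"
  by (simp add: map.rep_eq when_def)

lemma peval_map:
  assumes "h 0 = 0" "f 0 = 0"
  shows "peval h (Poly_Mapping.map f p) v = peval (h \<circ> f) p v"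
proof -
  have "Poly_Mapping.keys (Poly_Mapping.map f p) \<subseteq> Poly_Mapping.keys p"
    using assms by (auto simp: in_keys_iff lookup_map)
  then show ?thesis
    using peval_superset[of "Poly_Mapping.keys p" "Poly_Mapping.map f p" h v] assms
    by (simp add: lookup_map peval_def)
qed

text \<open>The index sets may exceed the supports, so that two different products can be expanded
  over the same indices and compared term by term, as \<open>mpoly_rel_mult\<close> does.\<close>

lemma lookup_mult_sum:
  fixes p q :: "'a::monoid_add \<Rightarrow>\<^sub>0 'b::semiring_0"
  assumes "finite A" "Poly_Mapping.keys p \<subseteq> A" "finite B" "Poly_Mapping.keys q \<subseteq> B"
  shows "Poly_Mapping.lookup (p * q) k =
    (\<Sum>a\<in>A. \<Sum>b\<in>B. if a + b = k then Poly_Mapping.lookup p a * Poly_Mapping.lookup q b else 0)"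
proof -
  have inner: "Sum_any (\<lambda>b. Poly_Mapping.lookup q b when k = a + b) =
      (\<Sum>b\<in>B. Poly_Mapping.lookup q b when k = a + b)" for a
    by (rule Sum_any.expand_superset) (use assms(3,4) in \<open>auto simp: in_keys_iff\<close>)
  have "Poly_Mapping.lookup (p * q) k =
      Sum_any (\<lambda>a. Poly_Mapping.lookup p a * (\<Sum>b\<in>B. Poly_Mapping.lookup q b when k = a + b))"
    by (simp add: lookup_mult inner)
  also have "\<dots> = (\<Sum>a\<in>A. Poly_Mapping.lookup p a * (\<Sum>b\<in>B. Poly_Mapping.lookup q b when k = a + b))"
    by (rule Sum_any.expand_superset) (use assms(1,2) in \<open>auto simp: in_keys_iff subset_iff dest!: mult_not_zero\<close>)
  also have "\<dots> = (\<Sum>a\<in>A. \<Sum>b\<in>B. if a + b = k then Poly_Mapping.lookup p a * Poly_Mapping.lookup q b else 0)"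
    unfolding sum_distrib_left by (intro sum.cong refl) (auto simp: when_def)
  finally show ?thesis .
qed

lemma peval_add:
  fixes p q :: "'b::comm_semiring_1 mpoly3"
  assumes "h 0 = 0" "\<And>a b. h (a + b) = h a + h b"
  shows "peval h (p + q) v = peval h p v + peval h q v"
proof -
  let ?A = "Poly_Mapping.keys p \<union> Poly_Mapping.keys q"
  have "Poly_Mapping.keys (p + q) \<subseteq> ?A" by (rule keys_add)
  then show ?thesis
    using peval_superset[of ?A _ h v] assms by (simp add: lookup_add distrib_right sum.distrib)
qed

lemma peval_mult:
  fixes p q :: "'b::comm_semiring_1 mpoly3"
  assumes h: "h 0 = 0" "\<And>a b. h (a + b) = h a + h b" "\<And>a b. h (a * b) = h a * h b"
  shows "peval h (p * q) v = peval h p v * peval h q v"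
proof -
  let ?A = "Poly_Mapping.keys p" and ?B = "Poly_Mapping.keys q"
  define C where "C = {a + b | a b. a \<in> ?A \<and> b \<in> ?B}"
  have C: "C = (\<lambda>(a, b). a + b) ` (?A \<times> ?B)" unfolding C_def by auto
  have fin: "finite C" unfolding C by simp
  have h_sum: "h (sum g S) = (\<Sum>i\<in>S. h (g i))" for g and S :: "'z set"
    by (induction S rule: infinite_finite_induct) (simp_all add: h)
  have "peval h (p * q) v = (\<Sum>k\<in>C. h (Poly_Mapping.lookup (p * q) k) * mon k v)"
    by (rule peval_superset) (use keys_mult[of p q] fin h(1) in \<open>auto simp: C_def\<close>)
  also have "\<dots> = (\<Sum>k\<in>C. \<Sum>a\<in>?A. \<Sum>b\<in>?B. if a + b = k then
      h (Poly_Mapping.lookup p a * Poly_Mapping.lookup q b) * mon k v else 0)"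
    by (subst lookup_mult_sum[of ?A _ ?B])
      (simp_all add: h_sum sum_distrib_right if_distrib[of h] h(1) if_distrib[of "\<lambda>z. z * _"] cong: if_cong)
  also have "\<dots> = (\<Sum>a\<in>?A. \<Sum>b\<in>?B. \<Sum>k\<in>C. if a + b = k then
      h (Poly_Mapping.lookup p a * Poly_Mapping.lookup q b) * mon k v else 0)"
    by (subst sum.swap) (intro sum.cong refl sum.swap)
  also have "\<dots> = (\<Sum>a\<in>?A. \<Sum>b\<in>?B. (h (Poly_Mapping.lookup p a) * mon a v) * (h (Poly_Mapping.lookup q b) * mon b v))"
  proof (intro sum.cong refl)
    fix a b assume "a \<in> ?A" "b \<in> ?B"
    then have "a + b \<in> C" unfolding C_def by auto
    then show "(\<Sum>k\<in>C. if a + b = k then h (Poly_Mapping.lookup p a * Poly_Mapping.lookup q b) * mon k v else 0)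
      = (h (Poly_Mapping.lookup p a) * mon a v) * (h (Poly_Mapping.lookup q b) * mon b v)"
      using fin by (simp add: sum.delta' h mon_add mult_ac)
  qed
  also have "\<dots> = peval h p v * peval h q v"
    by (simp add: peval_def sum_product)
  finally show ?thesis .
qed

lemma peval_0 [simp]: "peval h 0 v = 0"
  by (simp add: peval_def)

lemma peval_1: "h 1 = 1 \<Longrightarrow> peval h (1 :: 'b::comm_semiring_1 mpoly3) v = 1"
  by (simp add: peval_def lookup_one)

lemma eval3_prod: "eval3 (prod p A) v = (\<Prod>x\<in>A. eval3 (p x) v)"
  by (induction A rule: infinite_finite_induct)
    (simp_all add: eval3_eq_peval peval_1 peval_mult)

section \<open>Homogeneous parts of sums of squares\<close>

lemma peval_sum_squares:
  fixes ps :: "rat mpoly3 list" and v :: "'a::field_char_0 ^ 3"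
  shows "peval of_rat (\<Sum>p\<leftarrow>ps. p ^ 2) v = (\<Sum>p\<leftarrow>ps. (peval of_rat p v) ^ 2)"
  by (induction ps) (simp_all add: peval_add peval_mult of_rat_add of_rat_mult power2_eq_square)

text \<open>The homogeneous component of degree k as a function, polymorphic in the field:
  positivity is used over the reals, Galois conjugation over the complex numbers.\<close>

definition hpart :: "nat \<Rightarrow> rat mpoly3 \<Rightarrow> 'a::field_char_0 ^ 3 \<Rightarrow> 'a" where
  "hpart k p v = (\<Sum>m | m \<in> Poly_Mapping.keys p \<and> monom_degree m = k.
     of_rat (Poly_Mapping.lookup p m) * mon m v)"

lemma coeff_mult_degree_le:
  fixes f g :: "'a::comm_semiring_1 poly"
  assumes "Polynomial.degree f \<le> n" "Polynomial.degree g \<le> m"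
  shows "poly.coeff (f * g) (n + m) = poly.coeff f n * poly.coeff g m"
proof -
  have "poly.coeff f i * poly.coeff g (n + m - i) = 0" if "i \<noteq> n" "i \<le> n + m" for i
  proof (cases "i < n")
    case True
    then show ?thesis using assms that by (simp add: coeff_eq_0)
  qed (use assms that in \<open>simp add: coeff_eq_0\<close>)
  then have "(\<Sum>i\<le>n + m. poly.coeff f i * poly.coeff g (n + m - i)) =
      (\<Sum>i\<in>{n}. poly.coeff f i * poly.coeff g (n + m - i))"
    by (intro sum.mono_neutral_right) auto
  then show ?thesis by (simp add: coeff_mult)
qed

text \<open>With N the largest degree occurring, the coefficient in degree 2N is the sum of the
  squares of the coefficients in degree N. Over the reals these cannot cancel, so N > k would
  contradict the right-hand side.\<close>

lemma sum_squares_degree_le: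
  fixes gs :: "real poly list"
  assumes "(\<Sum>g\<leftarrow>gs. g ^ 2) = Polynomial.monom c (2 * k)"
  shows "\<forall>g\<in>set gs. Polynomial.degree g \<le> k" and "c = (\<Sum>g\<leftarrow>gs. (poly.coeff g k) ^ 2)"
proof -
  have coeff_2N: "poly.coeff (\<Sum>g\<leftarrow>hs. g ^ 2) (2 * N) = (\<Sum>g\<leftarrow>hs. (poly.coeff g N) ^ 2)"
    if "\<forall>g\<in>set hs. Polynomial.degree g \<le> N" for N and hs :: "real poly list"
    using that
    by (induction hs) (simp_all add: power2_eq_square coeff_mult_degree_le mult_2)
  show deg: "\<forall>g\<in>set gs. Polynomial.degree g \<le> k"
  proof (rule ccontr)
    assume "\<not> ?thesis"
    then obtain g0 where g0: "g0 \<in> set gs" "Polynomial.degree g0 > k" by auto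
    define N where "N = Max (Polynomial.degree ` set gs)"
    have le: "\<forall>g\<in>set gs. Polynomial.degree g \<le> N" unfolding N_def by simp
    have "N \<in> Polynomial.degree ` set gs" unfolding N_def using g0 by (intro Max_in) auto
    then obtain g where g: "g \<in> set gs" "Polynomial.degree g = N" by auto
    have "N > k" using le g0 by fastforce
    then have "(\<Sum>g\<leftarrow>gs. (poly.coeff g N) ^ 2) = 0"
      using coeff_2N[OF le] assms by simp
    then have "(poly.coeff g N) ^ 2 = 0"
      using g(1) by (subst (asm) sum_list_nonneg_eq_0_iff) auto
    then have "g = 0" using g(2) by auto
    then show False using g(2) \<open>N > k\<close> by simp
  qed
  show "c = (\<Sum>g\<leftarrow>gs. (poly.coeff g k) ^ 2)"
    using coeff_2N[OF deg] assms by simp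
qed

text \<open>Along the line t v each p becomes a real polynomial in t whose coefficient of t^k is
  \<open>hpart k p v\<close>, while f becomes a single monomial of degree 2k. Comparing these
  coefficients replaces every p by its degree-k part.\<close>

lemma sum_squares_hpart:
  fixes v :: "real ^ 3"
  assumes f: "f = (\<Sum>p\<leftarrow>ps. p ^ 2)"
    and hom: "\<And>t. peval of_rat f (t *s v) = t ^ (2 * k) * peval of_rat f v"
  shows "peval of_rat f v = (\<Sum>p\<leftarrow>ps. (hpart k p v) ^ 2)"
proof -
  define g where "g = (\<lambda>p. \<Sum>m\<in>Poly_Mapping.keys p.
    Polynomial.monom (of_rat (Poly_Mapping.lookup p m) * mon m v) (monom_degree m))"
  have poly_g: "poly (g p) t = peval of_rat p (t *s v)" for p t
    by (simp add: g_def poly_sum poly_monom peval_def mon_scale mult_ac)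
  have coeff_g: "poly.coeff (g p) k = hpart k p v" for p
    by (simp add: g_def coeff_sum hpart_def sum.If_cases Int_def)
  have "(\<Sum>p\<leftarrow>map g ps. p ^ 2) = Polynomial.monom (peval of_rat f v) (2 * k)"
  proof -
    have "poly (\<Sum>p\<leftarrow>map g qs. p ^ 2) t = (\<Sum>p\<leftarrow>qs. (peval of_rat p (t *s v)) ^ 2)" for qs t
      by (induction qs) (simp_all add: poly_g)
    then have "poly (\<Sum>p\<leftarrow>map g ps. p ^ 2) t = peval of_rat f (t *s v)" for t
      unfolding f peval_sum_squares by simp
    then have "poly (\<Sum>p\<leftarrow>map g ps. p ^ 2) = poly (Polynomial.monom (peval of_rat f v) (2 * k))"
      by (simp add: fun_eq_iff hom poly_monom mult.commute)
    then show ?thesis by (simp only: poly_eq_poly_eq_iff)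
  qed
  from sum_squares_degree_le(2)[OF this] show ?thesis by (simp add: coeff_g o_def)
qed

text \<open>Only restrictions to affine lines matter below, so a form is kept as a function and its
  coefficients are not recorded.\<close>

definition form :: "nat \<Rightarrow> ('a::field ^ 3 \<Rightarrow> 'a) \<Rightarrow> bool" where
  "form k q \<longleftrightarrow> (\<forall>w v. \<exists>g. Polynomial.degree g \<le> k \<and> poly.coeff g k = q v \<and> (\<forall>t. poly g t = q (w + t *s v)))
     \<and> (\<forall>t v. q (t *s v) = t ^ k * q v)"

lemma form_hpart: "form k (hpart k p :: 'a::field_char_0 ^ 3 \<Rightarrow> 'a)"
  unfolding form_def
proof (intro conjI allI)
  fix w v :: "'a ^ 3"
  \<comment> \<open>A degree bound together with the coefficient at the bound, which may be 0.
    Unlike the true leading coefficient this works uniformly even when coordinates of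
    \<open>v\<close> vanish, and it is multiplicative.\<close>
  define lead where "lead = (\<lambda>g n (c :: 'a). Polynomial.degree g \<le> n \<and> poly.coeff g n = c)"
  have lead_mult: "lead (f * g) (n + m) (c * d)" if "lead f n c" "lead g m d" for f g n m c d
    using that coeff_mult_degree_le[of f n g m] degree_mult_le[of f g] unfolding lead_def by auto
  have lead_1: "lead 1 0 1" unfolding lead_def by simp
  have lead_power: "lead (f ^ j) (j * n) (c ^ j)" if "lead f n c" for f n c j
    by (induction j) (use lead_1 lead_mult[OF that] in auto)
  have lead_prod: "lead (\<Prod>i\<in>A. f i) (\<Sum>i\<in>A. n i) (\<Prod>i\<in>A. c i)" if "\<And>i. lead (f i) (n i) (c i)"
    for f n c and A :: "3 set"
    by (induction A rule: infinite_finite_induct) (use lead_1 lead_mult[OF that] in auto)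
  have lin: "lead [:w $ i, v $ i:] 1 (v $ i)" for i unfolding lead_def by simp
  define G where "G = (\<lambda>m. \<Prod>i\<in>UNIV. [:w $ i, v $ i:] ^ Poly_Mapping.lookup m i)"
  have G: "lead (G m) (monom_degree m) (mon m v)" for m
    unfolding G_def monom_degree_def mon_def
    by (rule lead_prod) (use lead_power[OF lin] in simp)
  have poly_G: "poly (G m) t = mon m (w + t *s v)" for m t
    by (simp add: G_def mon_def poly_prod)
  define g where "g = (\<Sum>m | m \<in> Poly_Mapping.keys p \<and> monom_degree m = k.
     smult (of_rat (Poly_Mapping.lookup p m)) (G m))"
  show "\<exists>g. Polynomial.degree g \<le> k \<and> poly.coeff g k = hpart k p v \<and> (\<forall>t. poly g t = hpart k p (w + t *s v))"
  proof (intro exI[of _ g] conjI allI)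
    show "Polynomial.degree g \<le> k" unfolding g_def
      by (rule degree_sum_le) (use G in \<open>auto simp: lead_def intro: order_trans[OF degree_smult_le]\<close>)
    show "poly.coeff g k = hpart k p v"
      using G unfolding g_def hpart_def coeff_sum by (intro sum.cong) (auto simp: lead_def)
    show "poly g t = hpart k p (w + t *s v)" for t
      by (simp add: g_def hpart_def poly_sum poly_G)
  qed
next
  show "hpart k p (t *s v) = t ^ k * hpart k p v" for t and v :: "'a ^ 3"
    unfolding hpart_def sum_distrib_left by (intro sum.cong) (auto simp: mon_scale)
qed

section \<open>Lines in the projective plane and their intersections\<close>

abbreviation cvec :: "real ^ 3 \<Rightarrow> complex ^ 3" where
  "cvec v \<equiv> (\<chi> i. complex_of_real (v $ i))"

lemma mon_cvec: "mon m (cvec v) = of_real (mon m v)"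
  by (simp add: mon_def)

lemma of_real_of_rat: "of_real (of_rat q) = (of_rat q :: complex)"
  by (cases q) (simp add: of_rat_rat)

lemma peval_cvec: "peval of_rat p (cvec v) = of_real (peval of_rat p v)"
  by (simp add: peval_def mon_cvec of_real_of_rat)

lemma hpart_cvec: "hpart k p (cvec v) = of_real (hpart k p v)"
  by (simp add: hpart_def mon_cvec of_real_of_rat)

definition dot :: "'a::comm_ring_1 ^ 3 \<Rightarrow> 'a ^ 3 \<Rightarrow> 'a" where
  "dot a v = a $ 1 * v $ 1 + a $ 2 * v $ 2 + a $ 3 * v $ 3"

text \<open>Homogeneous coordinates of the intersection point of the lines \<open>a\<close> and
  \<open>b\<close>. Being polynomial with integer coefficients, they are compatible with embeddings
  and with complex conjugation.\<close>

definition cross :: "'a::comm_ring_1 ^ 3 \<Rightarrow> 'a ^ 3 \<Rightarrow> 'a ^ 3" where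
  "cross a b = vector [a $ 2 * b $ 3 - a $ 3 * b $ 2, a $ 3 * b $ 1 - a $ 1 * b $ 3, a $ 1 * b $ 2 - a $ 2 * b $ 1]"

lemma vec3_eq_iff: "v = w \<longleftrightarrow> v $ 1 = w $ 1 \<and> v $ 2 = w $ 2 \<and> v $ (3 :: 3) = w $ 3"
  by (simp add: vec_eq_iff forall_3)

lemma dot_cross [simp]: "dot a (cross a b) = 0" "dot b (cross a b) = 0"
  by (simp_all add: dot_def cross_def algebra_simps)

lemma dot_linear: "dot a (v + w) = dot a v + dot a w" "dot a (t *s v) = t * dot a v"
  "dot a (v - w) = dot a v - dot a w" "dot (v - w) a = dot v a - dot w a" "dot (t *s v) a = t * dot v a"
  by (simp_all add: dot_def algebra_simps)

text \<open>The triple product expansion u x (a x b) = (b.u) a - (a.u) b makes \<open>u\<close> and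
  \<open>cross a b\<close> proportional; dividing by a nonzero coordinate of
  \<open>cross a b\<close> produces the factor.\<close>

lemma cross_dot_zero:
  fixes a b u :: "'a::field ^ 3"
  assumes "cross a b \<noteq> 0" "dot a u = 0" "dot b u = 0"
  shows "\<exists>c. u = c *s cross a b"
proof -
  define w where "w = cross a b"
  have "cross u w = dot b u *s a - dot a u *s b"
    by (simp add: w_def vec3_eq_iff cross_def dot_def algebra_simps)
  then have z: "u $ 2 * w $ 3 = u $ 3 * w $ 2" "u $ 3 * w $ 1 = u $ 1 * w $ 3" "u $ 1 * w $ 2 = u $ 2 * w $ 1"
    using assms(2,3) by (simp_all add: vec3_eq_iff cross_def)
  have "w $ 1 \<noteq> 0 \<or> w $ 2 \<noteq> 0 \<or> w $ 3 \<noteq> 0" using assms(1) by (auto simp: w_def vec3_eq_iff)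
  then have "u = (u $ 1 / w $ 1) *s w \<or> u = (u $ 2 / w $ 2) *s w \<or> u = (u $ 3 / w $ 3) *s w"
    using z by (auto simp: vec3_eq_iff field_simps)
  then show ?thesis unfolding w_def by blast
qed

lemma common_zero:
  fixes a b :: "'a::field ^ 3"
  shows "\<exists>v. v \<noteq> 0 \<and> dot a v = 0 \<and> dot b v = 0"
proof (cases "cross a b = 0")
  case False
  then show ?thesis by (intro exI[of _ "cross a b"]) simp
next
  case True
  then have z: "a $ 2 * b $ 3 = a $ 3 * b $ 2" "a $ 3 * b $ 1 = a $ 1 * b $ 3" "a $ 1 * b $ 2 = a $ 2 * b $ 1"
    by (simp_all add: vec3_eq_iff cross_def)
  consider "a \<noteq> 0" | "a = 0" "b \<noteq> 0" | "a = 0" "b = 0" by blast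
  then show ?thesis
  proof cases
    case 1
    \<comment> \<open>Both vectors lie on the line \<open>a\<close> and on the proportional
      \<open>b\<close>. They are not both zero, since together they contain every coordinate of
      \<open>a\<close> up to sign.\<close>
    define u v :: "'a ^ 3" where "u = vector [a $ 2, - a $ 1, 0]" and "v = vector [0, a $ 3, - a $ 2]"
    have "dot a u = 0" "dot b u = 0" "dot a v = 0" "dot b v = 0"
      using z by (simp_all add: dot_def u_def v_def algebra_simps)
    moreover have "u \<noteq> 0 \<or> v \<noteq> 0" using 1 by (auto simp: vec3_eq_iff u_def v_def)
    ultimately show ?thesis by blast
  next
    case 2
    define u v :: "'a ^ 3" where "u = vector [b $ 2, - b $ 1, 0]" and "v = vector [0, b $ 3, - b $ 2]"
    have "dot b u = 0" "dot b v = 0" "dot a u = 0" "dot a v = 0"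
      using 2 by (simp_all add: dot_def u_def v_def algebra_simps)
    moreover have "u \<noteq> 0 \<or> v \<noteq> 0" using 2 by (auto simp: vec3_eq_iff u_def v_def)
    ultimately show ?thesis by blast
  next
    case 3
    then show ?thesis by (intro exI[of _ "vector [1, 0, 0]"]) (simp add: dot_def vec3_eq_iff)
  qed
qed

text \<open>Two dependent forms impose one condition at most beyond a third form, so all three share
  a zero. This is how general position for triples excludes proportional pairs.\<close>

lemma common_zero_cross_zero:
  fixes a b c :: "'a::field ^ 3"
  assumes "cross a b = 0"
  shows "\<exists>v. v \<noteq> 0 \<and> dot a v = 0 \<and> dot b v = 0 \<and> dot c v = 0"
proof (cases "a = 0")
  case True
  then show ?thesis using common_zero[of b c] by (auto simp: dot_def)
next
  case False
  obtain v where v: "v \<noteq> 0" "dot a v = 0" "dot c v = 0" using common_zero by blast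
  have z: "a $ 2 * b $ 3 = a $ 3 * b $ 2" "a $ 3 * b $ 1 = a $ 1 * b $ 3" "a $ 1 * b $ 2 = a $ 2 * b $ 1"
    using assms by (simp_all add: vec3_eq_iff cross_def)
  have "a $ 1 \<noteq> 0 \<or> a $ 2 \<noteq> 0 \<or> a $ 3 \<noteq> 0" using False by (auto simp: vec3_eq_iff)
  then have "b = (b $ 1 / a $ 1) *s a \<or> b = (b $ 2 / a $ 2) *s a \<or> b = (b $ 3 / a $ 3) *s a"
    using z by (auto simp: vec3_eq_iff field_simps)
  then have "dot b v = 0" using v(2) dot_linear(5) by (metis mult_zero_right)
  then show ?thesis using v by blast
qed

text \<open>The test vectors $(1, s, s^2)$ turn each linear form into a nonzero polynomial in \<open>s\<close>.\<close>

lemma real_vector_avoiding: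
  assumes "finite S" "0 \<notin> S"
  shows "\<exists>w. \<forall>b\<in>S. dot b (cvec w) \<noteq> 0"
proof -
  define R where "R = (\<Union>b\<in>S. {s. poly [:b $ 1, b $ 2, b $ 3:] s = 0})"
  have "[:b $ 1, b $ 2, b $ 3:] \<noteq> 0" if "b \<in> S" for b :: "complex ^ 3"
  proof -
    have "b \<noteq> 0" using that assms(2) by blast
    then show ?thesis by (auto simp: vec3_eq_iff)
  qed
  then have "finite R" unfolding R_def
    using assms(1) by (intro finite_UN_I poly_roots_finite)
  then have "finite {s :: real. complex_of_real s \<in> R}"
    using finite_vimageI[of R complex_of_real] by (simp add: inj_of_real vimage_def)
  then obtain s :: real where s: "complex_of_real s \<notin> R"
    using infinite_UNIV_char_0[where 'a=real] by (metis (mono_tags) UNIV_eq_I mem_Collect_eq)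
  have "dot b (cvec (vector [1, s, s^2])) = poly [:b $ 1, b $ 2, b $ 3:] s" for b
    by (simp add: dot_def power2_eq_square algebra_simps)
  then show ?thesis using s unfolding R_def by (intro exI[of _ "vector [1, s, s^2]"]) auto
qed

section \<open>Root counting along lines in general position\<close>

lemma zero_of_many_roots:
  fixes g :: "'a::field_char_0 poly"
  assumes "finite Y" "inj_on \<rho> Y" "\<And>y. y \<in> Y \<Longrightarrow> poly g (\<rho> y) = 0" "Polynomial.degree g < card Y"
  shows "g = 0"
proof (rule ccontr)
  assume g: "g \<noteq> 0"
  have "card Y = card (\<rho> ` Y)" using card_image[OF assms(2)] by simp
  also have "\<dots> \<le> card {z. poly g z = 0}"
    using assms(3) by (intro card_mono poly_roots_finite g) auto
  also have "\<dots> \<le> Polynomial.degree g" by (rule card_poly_roots_bound[OF g])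
  finally show False using assms(4) by simp
qed

text \<open>The bound on \<open>card_A\<close> supplies a third line for every pair, so that the
  condition on triples also controls pairs and single lines.\<close>

locale general_lines =
  fixes A :: "'x set" and a :: "'x \<Rightarrow> complex ^ 3"
  assumes finite_A: "finite A" and card_A: "card A \<ge> 3"
    and general: "x \<in> A \<Longrightarrow> y \<in> A \<Longrightarrow> z \<in> A \<Longrightarrow> x \<noteq> y \<Longrightarrow> x \<noteq> z \<Longrightarrow> y \<noteq> z \<Longrightarrow>
      dot (a x) v = 0 \<Longrightarrow> dot (a y) v = 0 \<Longrightarrow> dot (a z) v = 0 \<Longrightarrow> v = 0"
begin

lemma cross_nonzero:
  assumes "x \<in> A" "y \<in> A" "x \<noteq> y"
  shows "cross (a x) (a y) \<noteq> 0"
proof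
  assume *: "cross (a x) (a y) = 0"
  have "A - {x, y} \<noteq> {}"
  proof
    assume "A - {x, y} = {}"
    then have "card A \<le> card {x, y}" by (intro card_mono) auto
    also have "\<dots> \<le> 2" by (simp add: card_insert_if)
    finally show False using card_A by simp
  qed
  then obtain z where "z \<in> A" "z \<noteq> x" "z \<noteq> y" by auto
  then show False using common_zero_cross_zero[OF *, of "a z"] general[of x y z] assms by metis
qed

lemma coeff_nonzero:
  assumes "x \<in> A"
  shows "a x \<noteq> 0"
proof
  assume "a x = 0"
  have "A - {x} \<noteq> {}"
  proof
    assume "A - {x} = {}"
    then have "card A \<le> card {x}" by (intro card_mono) auto
    then show False using card_A by simp
  qed
  then obtain y where "y \<in> A" "y \<noteq> x" by auto
  then show False using cross_nonzero[OF assms, of y] \<open>a x = 0\<close> by (auto simp: cross_def vec3_eq_iff)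
qed

text \<open>On the line through the zero \<open>P\<close> and \<open>r\<close> the degree of \<open>q\<close> drops below \<open>k\<close>, while it still
  meets the \<open>k\<close> remaining lines.\<close>

lemma form_zero_on_line:
  assumes q: "form k q" and x: "x \<in> A" and M: "M \<subseteq> A" "x \<notin> M" "card M > k"
    and zero: "\<And>y. y \<in> M \<Longrightarrow> q (cross (a x) (a y)) = 0"
    and r: "dot (a x) r = 0"
  shows "q r = 0"
proof -
  have finM: "finite M" using finite_subset[OF M(1) finite_A] .
  obtain y0 where y0: "y0 \<in> M" using M(3) by fastforce
  define P where "P = cross (a x) (a y0)"
  define Y where "Y = M - {y0}"
  have Y: "finite Y" "card Y \<ge> k" "Y \<subseteq> A" "x \<notin> Y" "y0 \<notin> Y"
    using finM M y0 by (auto simp: Y_def)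
  have xy0: "x \<noteq> y0" "y0 \<in> A" using y0 M by auto
  have P: "P \<noteq> 0" "dot (a x) P = 0" "dot (a y0) P = 0"
    using cross_nonzero[OF x xy0(2,1)] by (simp_all add: P_def)
  obtain g where g: "Polynomial.degree g \<le> k" "poly.coeff g k = q P" "\<And>t. poly g t = q (r + t *s P)"
    using q unfolding form_def by blast
  \<comment> \<open>No third line passes through the intersection \<open>P\<close> of the lines
    \<open>x\<close> and \<open>y0\<close>.\<close>
  have yP: "dot (a y) P \<noteq> 0" if "y \<in> Y" for y
    using general[of x y0 y P] x xy0 P that Y by blast
  define \<rho> where "\<rho> = (\<lambda>y. - dot (a y) r / dot (a y) P)"
  have on_y: "dot (a y) (r + \<rho> y *s P) = 0" if "y \<in> Y" for y
    using yP[OF that] by (simp add: \<rho>_def dot_linear)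
  have on_x: "dot (a x) (r + t *s P) = 0" for t using r P by (simp add: dot_linear)
  have root: "poly g (\<rho> y) = 0" if y: "y \<in> Y" for y
  proof -
    have "y \<in> A" "x \<noteq> y" using y Y by auto
    then obtain c where c: "r + \<rho> y *s P = c *s cross (a x) (a y)"
      using cross_dot_zero[OF cross_nonzero[OF x] on_x on_y[OF y]] by blast
    have "q (c *s cross (a x) (a y)) = c ^ k * q (cross (a x) (a y))" using q unfolding form_def by blast
    then show ?thesis unfolding g(3) c using zero[of y] y by (simp add: Y_def)
  qed
  have qP: "q P = 0" using zero[OF y0] by (simp add: P_def)
  show ?thesis
  proof (cases "inj_on \<rho> Y")
    case True
    have "g = 0"
    proof (rule ccontr)
      assume "g \<noteq> 0"
      then have "Polynomial.degree g < k"
        using g(1,2) qP by (metis eq_zero_or_degree_less)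
      then show False using zero_of_many_roots[OF Y(1) True root] Y(2) \<open>g \<noteq> 0\<close> by force
    qed
    then show ?thesis using g(3)[of 0] by simp
  next
    \<comment> \<open>Equal parameters give a vector on the three lines x, y, z, hence the zero
      vector: \<open>r\<close> is then a multiple of \<open>P\<close>, where \<open>q\<close> is
      already known to vanish.\<close>
    case False
    then obtain y z where yz: "y \<in> Y" "z \<in> Y" "y \<noteq> z" "\<rho> y = \<rho> z" by (auto simp: inj_on_def)
    have "r + \<rho> y *s P = 0"
      using general[of x y z] x yz Y on_x on_y[OF yz(1)] on_y[OF yz(2)] by (metis subsetD)
    then have "r = (- \<rho> y) *s P" by (simp add: vec_eq_iff add_eq_0_iff2)
    moreover have "q ((- \<rho> y) *s P) = (- \<rho> y) ^ k * q P" using q unfolding form_def by blast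
    ultimately show ?thesis using qP by simp
  qed
qed

text \<open>The hypothesis on \<open>w\<close> says that the line w + t v meets the lines of A at
  pairwise distinct parameters. These are more roots than the degree k allows.\<close>

lemma form_zero:
  assumes q: "form k q" and k: "k < card A"
    and zero: "\<And>x r. x \<in> A \<Longrightarrow> dot (a x) r = 0 \<Longrightarrow> q r = 0"
    and v: "\<And>x. x \<in> A \<Longrightarrow> dot (a x) v \<noteq> 0"
    and w: "\<And>x y. x \<in> A \<Longrightarrow> y \<in> A \<Longrightarrow> x \<noteq> y \<Longrightarrow> dot (a x) w * dot (a y) v \<noteq> dot (a y) w * dot (a x) v"
  shows "q w = 0"
proof -
  obtain g where g: "Polynomial.degree g \<le> k" "\<And>t. poly g t = q (w + t *s v)"
    using q unfolding form_def by blast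
  define \<rho> where "\<rho> = (\<lambda>x. - dot (a x) w / dot (a x) v)"
  have "inj_on \<rho> A"
  proof (rule inj_onI, rule ccontr)
    fix x y assume xy: "x \<in> A" "y \<in> A" "\<rho> x = \<rho> y" "x \<noteq> y"
    then show False using w[OF xy(1,2,4)] v[OF xy(1)] v[OF xy(2)] by (simp add: \<rho>_def field_simps)
  qed
  moreover have "poly g (\<rho> x) = 0" if "x \<in> A" for x
    unfolding g(2) using v[OF that] by (intro zero[OF that]) (simp add: dot_linear \<rho>_def)
  ultimately have "g = 0" using finite_A g(1) k by (intro zero_of_many_roots[of A \<rho>]) auto
  then show ?thesis using g(2)[of 0] by simp
qed

text \<open>Finitely many nonzero linear forms have to be avoided: each a x, and each
  \<open>b x y\<close>, whose value at w is the difference of the two products. The latter is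
  nonzero because a x and a y are not proportional. A real w is required since positivity holds at
  real vectors.\<close>

lemma real_generic_vector:
  assumes "\<And>x. x \<in> A \<Longrightarrow> dot (a x) v \<noteq> 0"
  shows "\<exists>w. (\<forall>x\<in>A. dot (a x) (cvec w) \<noteq> 0) \<and> (\<forall>x\<in>A. \<forall>y\<in>A. x \<noteq> y \<longrightarrow>
    dot (a x) (cvec w) * dot (a y) v \<noteq> dot (a y) (cvec w) * dot (a x) v)"
proof -
  define b where "b = (\<lambda>x y. dot (a y) v *s a x - dot (a x) v *s a y)"
  have b0: "b x y \<noteq> 0" if xy: "x \<in> A" "y \<in> A" "x \<noteq> y" for x y
  proof
    assume "b x y = 0"
    then have *: "dot (a y) v *s a x = dot (a x) v *s a y" by (simp add: b_def)
    have "dot (a y) v *s cross (a x) (a y) = cross (dot (a y) v *s a x) (a y)"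
      by (simp add: cross_def vec3_eq_iff algebra_simps)
    also have "\<dots> = 0" unfolding * by (simp add: cross_def vec3_eq_iff algebra_simps)
    finally show False using assms[OF xy(2)] cross_nonzero[OF xy] by (simp add: vector_mul_eq_0)
  qed
  define S where "S = a ` A \<union> (\<lambda>(x, y). b x y) ` {z \<in> A \<times> A. fst z \<noteq> snd z}"
  have "finite S" unfolding S_def using finite_A by auto
  moreover have "c \<noteq> 0" if "c \<in> S" for c
    using that unfolding S_def
    by (elim UnE imageE) (simp_all add: coeff_nonzero b0 case_prod_beta mem_Times_iff)
  ultimately obtain w where w: "\<And>c. c \<in> S \<Longrightarrow> dot c (cvec w) \<noteq> 0"
    using real_vector_avoiding[of S] by blast
  have "dot (b x y) (cvec w) \<noteq> 0" if "x \<in> A" "y \<in> A" "x \<noteq> y" for x y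
    using that unfolding S_def by (intro w) (auto simp: S_def intro!: image_eqI[of _ _ "(x, y)"])
  moreover have "dot (b x y) (cvec w) = dot (a x) (cvec w) * dot (a y) v - dot (a y) (cvec w) * dot (a x) v" for x y
    by (simp add: b_def dot_linear mult.commute)
  ultimately show ?thesis using w by (intro exI[of _ w]) (auto simp: S_def)
qed

end

section \<open>The norm form\<close>

context partial_embedding
begin

definition mpoly_rel :: "complex mpoly3 \<Rightarrow> complex mpoly3 \<Rightarrow> bool" where
  "mpoly_rel P Q \<longleftrightarrow> (\<forall>m. (Poly_Mapping.lookup P m, Poly_Mapping.lookup Q m) \<in> r)"

lemma mpoly_rel_mult:
  assumes "mpoly_rel P Q" "mpoly_rel P' Q'"
  shows "mpoly_rel (P * P') (Q * Q')"
  unfolding mpoly_rel_def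
proof
  fix m
  let ?A = "Poly_Mapping.keys P \<union> Poly_Mapping.keys Q"
  let ?B = "Poly_Mapping.keys P' \<union> Poly_Mapping.keys Q'"
  have "Poly_Mapping.lookup (P * P') m =
      (\<Sum>i\<in>?A. \<Sum>j\<in>?B. if i + j = m then Poly_Mapping.lookup P i * Poly_Mapping.lookup P' j else 0)"
    by (rule lookup_mult_sum) auto
  moreover have "Poly_Mapping.lookup (Q * Q') m =
      (\<Sum>i\<in>?A. \<Sum>j\<in>?B. if i + j = m then Poly_Mapping.lookup Q i * Poly_Mapping.lookup Q' j else 0)"
    by (rule lookup_mult_sum) auto
  moreover have "(\<Sum>i\<in>?A. \<Sum>j\<in>?B. if i + j = m then Poly_Mapping.lookup P i * Poly_Mapping.lookup P' j else 0,
      \<Sum>i\<in>?A. \<Sum>j\<in>?B. if i + j = m then Poly_Mapping.lookup Q i * Poly_Mapping.lookup Q' j else 0) \<in> r"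
    using assms zero mult unfolding mpoly_rel_def by (intro sum) simp
  ultimately show "(Poly_Mapping.lookup (P * P') m, Poly_Mapping.lookup (Q * Q') m) \<in> r" by metis
qed

lemma mpoly_rel_prod:
  "(\<And>i. i \<in> A \<Longrightarrow> mpoly_rel (P i) (Q i)) \<Longrightarrow> mpoly_rel (prod P A) (prod Q A)"
proof (induction A rule: infinite_finite_induct)
  case (insert i A)
  then show ?case by (simp add: mpoly_rel_mult)
qed (simp_all add: mpoly_rel_def lookup_one when_def zero one)

text \<open>The coefficients of p are rational and hence fixed, so the embedding acts on the
  argument alone.\<close>

lemma hpart_rel:
  assumes "\<And>i. (v $ i, w $ i) \<in> r"
  shows "(hpart k p v, hpart k p w) \<in> r"
  unfolding hpart_def mon_def by (intro sum mult rat prod power assms)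

lemma cross_rel:
  assumes "\<And>i. (v $ i, w $ i) \<in> r" "\<And>i. (v' $ i, w' $ i) \<in> r"
  shows "(cross v v' $ i, cross w w' $ i) \<in> r"
  using exhaust_3[of i] by (auto simp: cross_def intro!: diff mult assms)

end

section \<open>Linear forms as coefficient vectors and rationality of the norm form\<close>

lemma monom_degree_1_iff: "monom_degree m = 1 \<longleftrightarrow> (\<exists>i. m = Poly_Mapping.single i 1)"
proof
  assume "monom_degree m = 1"
  then obtain i where "Poly_Mapping.lookup m i = 1" "\<And>j. i \<noteq> j \<Longrightarrow> Poly_Mapping.lookup m j = 0"
    unfolding monom_degree_def using sum_eq_1_iff[of UNIV "Poly_Mapping.lookup m"] by auto
  then have "m = Poly_Mapping.single i 1"
    by (intro poly_mapping_eqI) (auto simp: lookup_single when_def)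
  then show "\<exists>i. m = Poly_Mapping.single i 1" by blast
next
  assume "\<exists>i. m = Poly_Mapping.single i 1"
  then show "monom_degree m = 1" by (auto simp: monom_degree_def lookup_single when_def)
qed

lemma mon_single: "mon (Poly_Mapping.single i 1) v = v $ i"
proof -
  have "mon (Poly_Mapping.single i 1) v = (\<Prod>j\<in>UNIV. if i = j then v $ j else 1)"
    unfolding mon_def by (intro prod.cong) (auto simp: lookup_single when_def)
  then show ?thesis by simp
qed

lemma eval3_map_linear_form:
  fixes h :: "complex \<Rightarrow> complex"
  assumes "linear_form_over K l" "h 0 = 0"
  shows "eval3 (map_coeffs h l) v = dot (\<chi> i. h (Poly_Mapping.lookup l (Poly_Mapping.single i 1))) v"
proof -
  let ?s = "\<lambda>i :: 3. Poly_Mapping.single i (1 :: nat)"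
  have inj: "inj ?s" by (intro injI) (metis lookup_single_eq lookup_single_not_eq zero_neq_one)
  have "eval3 (map_coeffs h l) v = peval h l v"
    using assms(2) by (simp add: eval3_eq_peval peval_map)
  also have "\<dots> = (\<Sum>m\<in>range ?s. h (Poly_Mapping.lookup l m) * mon m v)"
    using assms monom_degree_1_iff unfolding linear_form_over_def by (intro peval_superset) (simp, blast, simp)
  also have "\<dots> = (\<Sum>i\<in>UNIV. h (Poly_Mapping.lookup l (?s i)) * v $ i)"
    by (simp only: sum.reindex[OF inj] o_def mon_single)
  finally show ?thesis by (simp add: dot_def sum_3)
qed

text \<open>An automorphism permutes the embeddings and therefore the factors of the product, so it
  fixes each coefficient; \<open>fixed_rational\<close> applies.\<close>

lemma (in galois_embeddings) norm_form_rational: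
  assumes l: "linear_form_over K l"
  shows "\<exists>f :: rat mpoly3. map_coeffs of_rat f = norm_form K l"
proof -
  have x0: "x 0 = 0" if "x \<in> embeddings K" for x
    using embeddings_D(2)[OF that subfield_complexD(1)[OF K] subfield_complexD(1)[OF K]] by simp
  have lK: "Poly_Mapping.lookup l m \<in> K" for m using l by (simp add: linear_form_over_def)
  have fixed: "Poly_Mapping.lookup (norm_form K l) m \<in> L \<and>
      \<sigma> (Poly_Mapping.lookup (norm_form K l) m) = Poly_Mapping.lookup (norm_form K l) m"
    if s: "\<sigma> \<in> carrier (galois_group L)" for \<sigma> m
  proof -
    interpret \<sigma>: partial_embedding "{(a, \<sigma> a) | a. a \<in> L}" by (rule galois_group_graph[OF L s])
    have "\<sigma>.mpoly_rel (map_coeffs x l) (map_coeffs (compose K \<sigma> x) l)" if x: "x \<in> embeddings K" for x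
      unfolding \<sigma>.mpoly_rel_def using x0[OF x] x0[OF act_embedding[OF s x]] embedding_mem[OF x lK]
      by (auto simp: lookup_map compose_eq[OF lK])
    then have "\<sigma>.mpoly_rel (norm_form K l) (\<Prod>x\<in>embeddings K. map_coeffs (compose K \<sigma> x) l)"
      unfolding norm_form_def by (rule \<sigma>.mpoly_rel_prod)
    also have "(\<Prod>x\<in>embeddings K. map_coeffs (compose K \<sigma> x) l) = norm_form K l"
      unfolding norm_form_def by (rule prod.reindex_bij_betw[OF act_bij[OF s]])
    finally show ?thesis unfolding \<sigma>.mpoly_rel_def by auto
  qed
  have rational: "Poly_Mapping.lookup (norm_form K l) m \<in> \<rat>" for m
    \<comment> \<open>Conjugation serves here as a group element from which membership of the
      coefficients in \<open>L\<close> is read off.\<close>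
    using fixed_rational[OF L] fixed galois_cnj[OF L] by metis
  let ?g = "the_inv (of_rat :: rat \<Rightarrow> complex)"
  have inv: "?g (of_rat q) = q" for q by (intro the_inv_f_f injI) simp
  have "map_coeffs of_rat (map_coeffs ?g (norm_form K l)) = norm_form K l"
  proof (rule poly_mapping_eqI)
    fix m
    obtain q where q: "Poly_Mapping.lookup (norm_form K l) m = of_rat q"
      using rational[of m] by (auto simp: Rats_def)
    show "Poly_Mapping.lookup (map_coeffs of_rat (map_coeffs ?g (norm_form K l))) m = Poly_Mapping.lookup (norm_form K l) m"
      using inv[of 0] inv[of q] q by (simp add: lookup_map)
  qed
  then show ?thesis by blast
qed

text \<open>Conjugation exchanges the two factors and so changes the sign of the cross product,
  which is therefore purely imaginary: up to the scalar \<open>\<i>\<close> the intersection point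
  is real.\<close>

lemma cross_cnj:
  fixes a :: "complex ^ 3"
  shows "\<exists>R. cross a (\<chi> i. cnj (a $ i)) = \<i> *s cvec R"
proof (intro exI)
  show "cross a (\<chi> i. cnj (a $ i)) = \<i> *s cvec (\<chi> i. Im (cross a (\<chi> i. cnj (a $ i)) $ i))"
    by (simp add: vec3_eq_iff cross_def complex_eq_iff)
qed

section \<open>From a sum of squares to a real zero off all the lines\<close>

theorem theorem2p5:
  fixes K :: "complex set" and d :: nat and l :: "complex mpoly3"
  assumes "number_field_of_degree K (2 * d)"
    and "2 * d \<ge> 4"
    and "totally_imaginary K"
    and "property_star_star (galois_group (galois_hull K)) (embeddings K)
           (embedding_action K) (restricted_conjugation (galois_hull K))"
    and "linear_form_over K l"
    and "sufficiently_general K l"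
  shows "\<exists>f :: rat mpoly3. map_coeffs of_rat f = norm_form K l \<and> \<not> is_sum_of_squares f"
proof -
  define L where "L = galois_hull K"
  interpret galois_embeddings K L
  proof (rule galois_embeddings.intro)
    show "subfield K complex_field" using assms(1) by (simp add: number_field_of_degree_def)
    show "K \<subseteq> L" "galois_over_Q L"
      unfolding L_def using galois_galois_hull[OF number_field_algebraic[OF assms(1)]] by auto
    show "finite (embeddings K)" by (rule finite_embeddings[OF assms(1)])
  qed
  obtain f :: "rat mpoly3" where f: "map_coeffs of_rat f = norm_form K l"
    using norm_form_rational[OF assms(5)] by blast
  define E where "E = embeddings K"
  define a where "a = (\<lambda>x :: complex \<Rightarrow> complex. \<chi> i. x (Poly_Mapping.lookup l (Poly_Mapping.single i 1)))"
  have finE: "finite E" using fin by (simp add: E_def)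
  have x0: "x 0 = 0" if "x \<in> E" for x
    using embeddings_D(2)[OF _ subfield_complexD(1)[OF K] subfield_complexD(1)[OF K]] that by (simp add: E_def)
  have lK: "Poly_Mapping.lookup l m \<in> K" for m using assms(5) by (simp add: linear_form_over_def)
  have eval_l: "eval3 (map_coeffs x l) v = dot (a x) v" if "x \<in> E" for x v
    unfolding a_def by (rule eval3_map_linear_form[OF assms(5)]) (rule x0[OF that])
  have orbit: "orbit x \<subseteq> E" "x \<notin> orbit x" "2 * card (orbit x) > card E" if "x \<in> E" for x
    using orbit_subset not_mem_orbit[OF assms(3)] that assms(4) characteristic_number_eq
    unfolding property_star_star_def E_def L_def[symmetric] by auto
  obtain x1 where x1: "x1 \<in> E" using id_embedding[OF K] by (auto simp: E_def)
  \<comment> \<open>With n = \<open>card E\<close> this gives n < 2 (n - 1), hence n > 2: the third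
    line required by \<open>general_lines\<close>.\<close>
  have "card (orbit x1) \<le> card (E - {x1})"
    using orbit[OF x1] finE by (intro card_mono) auto
  then have card_E: "card E \<ge> 3" using orbit(3)[OF x1] x1 finE by (simp add: card_Diff_singleton)
  interpret general_lines E a
  proof
    fix x y z v
    assume "x \<in> E" "y \<in> E" "z \<in> E" "x \<noteq> y" "x \<noteq> z" "y \<noteq> z"
      "dot (a x) v = 0" "dot (a y) v = 0" "dot (a z) v = 0"
    then show "v = 0"
      using assms(6) eval_l unfolding sufficiently_general_def E_def[symmetric] by metis
  qed (use finE card_E in auto)
  define F where "F = (\<lambda>v :: real ^ 3. peval of_rat f v)"
  have F: "complex_of_real (F v) = (\<Prod>x\<in>E. dot (a x) (cvec v))" for v
  proof -
    have "complex_of_real (F v) = peval of_rat f (cvec v)" by (simp add: F_def peval_cvec)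
    also have "\<dots> = eval3 (map_coeffs of_rat f) (cvec v)"
      by (simp add: eval3_eq_peval peval_map)
    also have "\<dots> = (\<Prod>x\<in>E. dot (a x) (cvec v))"
      unfolding f norm_form_def eval3_prod E_def[symmetric] by (intro prod.cong) (auto simp: eval_l)
    finally show ?thesis .
  qed
  have F_scale: "F (t *s v) = t ^ card E * F v" for t v
  proof -
    have "cvec (t *s v) = complex_of_real t *s cvec v" by (simp add: vec_eq_iff)
    then have "complex_of_real (F (t *s v)) = complex_of_real (t ^ card E * F v)"
      unfolding F of_real_mult by (simp add: dot_linear prod.distrib)
    then show ?thesis by (simp only: of_real_eq_iff)
  qed
  have F_0_iff: "F v = 0 \<longleftrightarrow> (\<exists>x\<in>E. dot (a x) (cvec v) = 0)" for v
  proof -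
    have "F v = 0 \<longleftrightarrow> complex_of_real (F v) = 0" by simp
    also have "\<dots> \<longleftrightarrow> (\<exists>x\<in>E. dot (a x) (cvec v) = 0)" unfolding F by (rule prod_zero_iff[OF finE])
    finally show ?thesis .
  qed
  \<comment> \<open>A real vector off all the lines: it detects the parity of \<open>card E\<close>
    and later serves as direction of the final test line.\<close>
  obtain v0 where v0: "\<And>x. x \<in> E \<Longrightarrow> dot (a x) (cvec v0) \<noteq> 0"
  proof -
    have "0 \<notin> a ` E" using coeff_nonzero by force
    then show ?thesis using real_vector_avoiding[of "a ` E"] finE that by auto
  qed
  have "\<not> is_sum_of_squares f"
  proof
    assume "is_sum_of_squares f"
    then obtain ps where ps: "f = (\<Sum>p\<leftarrow>ps. p ^ 2)" unfolding is_sum_of_squares_def by blast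
    have F_nonneg: "F v \<ge> 0" for v
      unfolding F_def ps peval_sum_squares by (intro sum_list_nonneg) auto
    \<comment> \<open>In odd degree the values at v0 and -v0 would be opposite, nonnegative and
      nonzero.\<close>
    have "even (card E)"
    proof (rule ccontr)
      assume "odd (card E)"
      then have "F ((- 1) *s v0) = - F v0" unfolding F_scale by simp
      then have "F v0 = 0" using F_nonneg[of v0] F_nonneg[of "(- 1) *s v0"] by simp
      then show False using F_0_iff v0 by blast
    qed
    then obtain k where k: "card E = 2 * k" by (elim evenE)
    have F_sum: "F v = (\<Sum>p\<leftarrow>ps. (hpart k p v) ^ 2)" for v
      unfolding F_def by (rule sum_squares_hpart[OF ps]) (use F_scale in \<open>simp add: F_def k\<close>)
    have real_zero: "hpart k p v = 0" if "F v = 0" "p \<in> set ps" for p and v :: "real ^ 3"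
    proof -
      have "\<forall>z\<in>set (map (\<lambda>p. (hpart k p v) ^ 2) ps). z = 0"
        using that(1) unfolding F_sum by (subst (asm) sum_list_nonneg_eq_0_iff) auto
      then show ?thesis using that(2) by auto
    qed
    have cnj_zero: "hpart k p (cross (a z) (a (compose K cnj z))) = 0" if p: "p \<in> set ps" and z: "z \<in> E" for p z
    proof -
      have "a (compose K cnj z) = (\<chi> i. cnj (a z $ i))"
        by (simp add: a_def compose_eq lK)
      then obtain R where R: "cross (a z) (a (compose K cnj z)) = \<i> *s cvec R" using cross_cnj[of "a z"] by auto
      have "\<i> * dot (a z) (cvec R) = 0" using dot_cross(1)[of "a z"] unfolding dot_linear(2)[symmetric] R[symmetric] .
      then have "F R = 0" using F_0_iff z by auto
      then have "hpart k p (cvec R) = 0" using real_zero p by (simp add: hpart_cvec)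
      \<comment> \<open>Homogeneity absorbs the scalar \<open>\<i>\<close>, so vanishing at the real
        vector \<open>R\<close> is vanishing at the cross product.\<close>
      moreover have "hpart k p (\<i> *s cvec R) = \<i> ^ k * hpart k p (cvec R)"
        using form_hpart unfolding form_def by blast
      ultimately show ?thesis unfolding R by simp
    qed
    have orbit_zero: "hpart k p (cross (a x) (a y)) = 0" if p: "p \<in> set ps" and x: "x \<in> E" and y: "y \<in> orbit x" for p x y
    proof -
      obtain \<sigma> z where s: "\<sigma> \<in> carrier (galois_group L)" and z: "z \<in> E"
        and xy: "x = compose K \<sigma> z" "y = compose K \<sigma> (compose K cnj z)"
        using y orbit_iff x unfolding E_def by blast
      interpret \<sigma>: partial_embedding "{(u, \<sigma> u) | u. u \<in> L}" by (rule galois_group_graph[OF L s])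
      have rel: "(a w $ i, a (compose K \<sigma> w) $ i) \<in> {(u, \<sigma> u) | u. u \<in> L}" if "w \<in> E" for w i
        using embedding_mem[of w] that lK by (simp add: a_def compose_eq E_def)
      have "(hpart k p (cross (a z) (a (compose K cnj z))), hpart k p (cross (a x) (a y))) \<in> {(u, \<sigma> u) | u. u \<in> L}"
        unfolding xy using z cnj_embedding by (intro \<sigma>.hpart_rel \<sigma>.cross_rel rel) (auto simp: E_def)
      then show ?thesis unfolding cnj_zero[OF p z] by (rule \<sigma>.zero_unique)
    qed
    \<comment> \<open>As \<open>card E\<close> = 2k, the bound 2 \<open>card (orbit x)\<close> >
      \<open>card E\<close> means more than k known zeros on the line of x.\<close>
    have line_zero: "hpart k p r = 0" if "p \<in> set ps" "x \<in> E" "dot (a x) r = 0" for p x r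
      using form_zero_on_line[OF form_hpart that(2) orbit(1,2)[OF that(2)] _ orbit_zero[OF that(1,2)] that(3)]
        orbit(3)[OF that(2)] k by simp
    obtain w where w: "\<And>x. x \<in> E \<Longrightarrow> dot (a x) (cvec w) \<noteq> 0"
      "\<And>x y. x \<in> E \<Longrightarrow> y \<in> E \<Longrightarrow> x \<noteq> y \<Longrightarrow>
        dot (a x) (cvec w) * dot (a y) (cvec v0) \<noteq> dot (a y) (cvec w) * dot (a x) (cvec v0)"
      using real_generic_vector[OF v0] by blast
    \<comment> \<open>Here k < 2k = \<open>card E\<close>, because \<open>card E\<close> is
      positive.\<close>
    have "hpart k p (cvec w) = 0" if "p \<in> set ps" for p
      by (rule form_zero[OF form_hpart _ line_zero[OF that] v0 w(2)]) (use k card_E in auto)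
    then have "hpart k p w = 0" if "p \<in> set ps" for p using that by (simp add: hpart_cvec)
    then have "F w = 0" unfolding F_sum by (simp cong: map_cong)
    then show False using F_0_iff w(1) by blast
  qed
  then show ?thesis using f by blast
qed

end
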